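(* Let $G$ be a finite group. If $d^*(G)>\frac{4}{5}=d^*(D_8)=d'(D_8)$, then $G$ is an Iwasawa group. The equalities $d^*(D_8)=d'(D_8)=\frac{4}{5}$ are part of the assertion.
   Context: All groups are finite. For a finite group $G$, $L(G)$ denotes the set (lattice) of all subgroups of $G$, $k'(G)$ the number of conjugacy classes of subgroups of $G$, and $d'(G)=\frac{k'(G)}{|L(G)|}$. A section of $G$ is a quotient $H/K$ with $K\trianglelefteq H\leq G$, and $d^*(G)=\min\{d'(S)\mid S \text{ is a section of } G\}$. $D_8$ is the dihedral group of order 8. An Iwasawa group is a nilpotent group whose subgroup lattice is modular. *)

theory Defs
  imports "HOL-Algebra.Algebra"
begin

definition subgroup_lattice :: "('a, 'b) monoid_scheme \<Rightarrow> 'a set gorder" where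
  "subgroup_lattice G = \<lparr>carrier = {H. subgroup H G}, eq = (=), le = (\<subseteq>)\<rparr>"

definition subgroup_conj_classes :: "('a, 'b) monoid_scheme \<Rightarrow> 'a set set set" where
  "subgroup_conj_classes G =
     orbits G {H. subgroup H G}
       (\<lambda>g. \<lambda>H \<in> {H. subgroup H G}. g <#\<^bsub>G\<^esub> H #>\<^bsub>G\<^esub> (inv\<^bsub>G\<^esub> g))"

definition d_prime :: "('a, 'b) monoid_scheme \<Rightarrow> real" where
  "d_prime G = real (card (subgroup_conj_classes G)) / real (card (carrier (subgroup_lattice G)))"

definition sections :: "('a, 'b) monoid_scheme \<Rightarrow> 'a set monoid set" where
  "sections G = {(G\<lparr>carrier := H\<rparr>) Mod K | H K. subgroup H G \<and> K \<lhd> G\<lparr>carrier := H\<rparr>}"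

text \<open>For finite \<open>G\<close> the set below is finite and nonempty, so \<open>Min\<close> is a genuine minimum.\<close>

definition d_star :: "('a, 'b) monoid_scheme \<Rightarrow> real" where
  "d_star G = Min (d_prime ` sections G)"

text \<open>The lower central series, with \<open>lower_central G 0\<close> the whole group.\<close>

primrec lower_central :: "('a, 'b) monoid_scheme \<Rightarrow> nat \<Rightarrow> 'a set" where
  "lower_central G 0 = carrier G"
| "lower_central G (Suc n) =
     generate G (\<Union>x \<in> lower_central G n. \<Union>y \<in> carrier G.
       {x \<otimes>\<^bsub>G\<^esub> y \<otimes>\<^bsub>G\<^esub> inv\<^bsub>G\<^esub> x \<otimes>\<^bsub>G\<^esub> inv\<^bsub>G\<^esub> y})"

locale nilpotent_group = group +
  assumes nilpotent: "\<exists>n. lower_central G n = {\<one>}"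

locale modular_lattice = lattice +
  assumes modular:
    "\<lbrakk>x \<in> carrier L; y \<in> carrier L; z \<in> carrier L; x \<sqsubseteq> z\<rbrakk> \<Longrightarrow> x \<squnion> (y \<sqinter> z) = (x \<squnion> y) \<sqinter> z"

definition iwasawa_group :: "('a, 'b) monoid_scheme \<Rightarrow> bool" where
  "iwasawa_group G \<longleftrightarrow> nilpotent_group G \<and> modular_lattice (subgroup_lattice G)"

text \<open>
  The dihedral group of order \<open>2 * n\<close>, where \<open>(k, b)\<close> stands for \<open>r\<^sup>k s\<^sup>b\<close>
  with a rotation \<open>r\<close> of order \<open>n\<close> and a reflection \<open>s\<close>, subject to \<open>s r = r\<^sup>-\<^sup>1 s\<close>.
\<close>

definition dihedral_group :: "nat \<Rightarrow> (int \<times> bool) monoid" where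
  "dihedral_group n =
     \<lparr>carrier = {0..<int n} \<times> UNIV,
      monoid.mult = (\<lambda>(i, a) (j, b). ((if a then i - j else i + j) mod int n, a \<noteq> b)),
      one = (0, False)\<rparr>"

abbreviation D8 :: "(int \<times> bool) monoid" where
  "D8 \<equiv> dihedral_group 4"

lemma group_dihedral_group:
  assumes "n > 0"
  shows "group (dihedral_group n)"
proof (rule groupI)
  fix x y z
  assume "x \<in> carrier (dihedral_group n)" "y \<in> carrier (dihedral_group n)"
    "z \<in> carrier (dihedral_group n)"
  then show "x \<otimes>\<^bsub>dihedral_group n\<^esub> y \<otimes>\<^bsub>dihedral_group n\<^esub> z =
      x \<otimes>\<^bsub>dihedral_group n\<^esub> (y \<otimes>\<^bsub>dihedral_group n\<^esub> z)"
    by (auto simp: dihedral_group_def mod_simps algebra_simps)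
next
  fix x
  assume x: "x \<in> carrier (dihedral_group n)"
  obtain i a where [simp]: "x = (i, a)" by (cases x)
  have "((if a then i else - i) mod int n, a) \<otimes>\<^bsub>dihedral_group n\<^esub> x = \<one>\<^bsub>dihedral_group n\<^esub>"
    by (auto simp: dihedral_group_def mod_simps)
  moreover have "((if a then i else - i) mod int n, a) \<in> carrier (dihedral_group n)"
    using assms by (simp add: dihedral_group_def)
  ultimately show "\<exists>y \<in> carrier (dihedral_group n).
      y \<otimes>\<^bsub>dihedral_group n\<^esub> x = \<one>\<^bsub>dihedral_group n\<^esub>"
    by blast
qed (use assms in \<open>auto simp: dihedral_group_def\<close>)

lemma order_dihedral_group: "order (dihedral_group n) = 2 * n"
  by (simp add: order_def dihedral_group_def)

end

theory Submission
  imports Defs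
begin

text \<open>
  If \<open>d'(S) > 4/5\<close>, then counting nonnormal subgroups by conjugacy classes (each of size at
  least 2) shows that more than three fifths of the subgroups of \<open>S\<close> are normal. A nonnormal
  maximal subgroup of a subgroup of \<open>G\<close> would, modulo its core, give a primitive section with too
  few normal subgroups. Hence \<open>G\<close> satisfies the normalizer condition, so its nontrivial
  sections have nontrivial centres and \<open>G\<close> is nilpotent.

  For modularity it suffices that cyclic subgroups permute. In a minimal failure
  \<open>\<langle>x\<rangle>\<close>, \<open>\<langle>y\<rangle>\<close>, the subgroup
  \<open>N = \<langle>x\<^sup>p\<rangle> \<langle>y\<^sup>q\<rangle>\<close> is normalised by \<open>x\<close> and \<open>y\<close>, and
  \<open>\<langle>x, y\<rangle> / N\<close> is not abelian. Its nonabelian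
  quotient by a largest possible normal subgroup containing \<open>N\<close> has order \<open>p\<^sup>3\<close> and
  again has too few normal subgroups.
\<close>

section \<open>Subgroups, conjugates and normal subgroups\<close>

text \<open>The constant 4/5 enters through a single count. With n normal and a nonnormal subgroups
  there are at most n + a/2 classes, so d' > 4/5 gives 3a < 2n. The dihedral group of order 8 has n
  = 6 and a = 4, hence 3a = 2n: the count for the groups of order p^3 has no slack at p = 2. Both
  counts need a section with few normal subgroups, and this dictates which quotient is taken: by the
  core of the maximal subgroup, or by a normal subgroup maximal among those avoiding [x, y], so that
  [x, y] lies in every nontrivial normal subgroup of the quotient. The modular half depends on the
  nilpotent half. That x normalises \<langle>x^p\<rangle>\<langle>y^q\<rangle> is not clear in an
  arbitrary group; it follows from the normalizer condition. The same condition gives the last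
  section a nontrivial centre. The centre then contains [x, y], and a central commutator is
  multiplicative in each argument, which forces p = q and fixes the order of the section.\<close>

definition mostly_normal :: "('a, 'b) monoid_scheme \<Rightarrow> bool" where
  "mostly_normal G \<longleftrightarrow>
     3 * card {H. subgroup H G \<and> \<not> H \<lhd> G} < 2 * card {H. H \<lhd> G}"

text \<open>Inclusion of the conjugate in \<open>A\<close> is enough: in a finite group it is an
  equality, since a conjugate has as many elements as \<open>A\<close>. Quantifying over all pairs
  of subgroups of \<open>G\<close> makes the condition pass directly to subgroups.\<close>

definition normalizer_condition :: "('a, 'b) monoid_scheme \<Rightarrow> bool" where
  "normalizer_condition G \<longleftrightarrow>
     (\<forall>A B. subgroup A G \<longrightarrow> subgroup B G \<longrightarrow> A \<subset> B \<longrightarrow>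
        (\<exists>g \<in> B - A. \<forall>x \<in> A. g \<otimes>\<^bsub>G\<^esub> x \<otimes>\<^bsub>G\<^esub> inv\<^bsub>G\<^esub> g \<in> A))"

text \<open>An image is easier to calculate with than the product of cosets in
  \<open>subgroup_conj_classes\<close>; \<open>conjugate_set_eq\<close> identifies the two.\<close>

definition conjugate :: "('a, 'b) monoid_scheme \<Rightarrow> 'a \<Rightarrow> 'a set \<Rightarrow> 'a set" where
  "conjugate G g H = (\<lambda>h. g \<otimes>\<^bsub>G\<^esub> h \<otimes>\<^bsub>G\<^esub> inv\<^bsub>G\<^esub> g) ` H"

context group
begin

text \<open>In a right-associated word an element and its inverse are not a subterm of their own, so
  the two-factor laws do not cancel them. With these rules \<open>simp add: m_assoc\<close>
  normalises words.\<close>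

lemma mult_inv_cancel_left [simp]:
  assumes "x \<in> carrier G" "y \<in> carrier G"
  shows "x \<otimes> (inv x \<otimes> y) = y" "inv x \<otimes> (x \<otimes> y) = y"
  using assms by (simp_all flip: m_assoc)

text \<open>The set \<open>A\<close> is arbitrary so that one lemma covers centralisers of elements
  and of subgroups as well as the centre, where \<open>A\<close> is the whole carrier.\<close>

lemma subgroup_centralizer:
  assumes "A \<subseteq> carrier G"
  shows "subgroup {c \<in> carrier G. \<forall>v \<in> A. c \<otimes> v = v \<otimes> c} G"
proof (rule subgroupI)
  show "{c \<in> carrier G. \<forall>v \<in> A. c \<otimes> v = v \<otimes> c} \<noteq> {}"
    using assms by (auto intro!: exI[of _ \<one>])
  fix a assume a: "a \<in> {c \<in> carrier G. \<forall>v \<in> A. c \<otimes> v = v \<otimes> c}"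
  have "inv a \<otimes> v = v \<otimes> inv a" if v: "v \<in> A" for v
  proof -
    have ac: "a \<in> carrier G" "v \<in> carrier G" and c: "a \<otimes> v = v \<otimes> a"
      using a v assms by auto
    have "inv a \<otimes> v = inv a \<otimes> (v \<otimes> a) \<otimes> inv a" using ac by (simp add: m_assoc)
    also have "\<dots> = v \<otimes> inv a" unfolding c[symmetric] using ac by (simp add: m_assoc)
    finally show ?thesis .
  qed
  then show "inv a \<in> {c \<in> carrier G. \<forall>v \<in> A. c \<otimes> v = v \<otimes> c}" using a by auto
  fix b assume b: "b \<in> {c \<in> carrier G. \<forall>v \<in> A. c \<otimes> v = v \<otimes> c}"
  have "a \<otimes> b \<otimes> v = v \<otimes> (a \<otimes> b)" if v: "v \<in> A" for v
  proof -
    have c: "a \<in> carrier G" "b \<in> carrier G" "v \<in> carrier G"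
      and av: "a \<otimes> v = v \<otimes> a" and bv: "b \<otimes> v = v \<otimes> b"
      using a b v assms by auto
    have "a \<otimes> b \<otimes> v = a \<otimes> v \<otimes> b" using c by (simp add: m_assoc bv)
    also have "\<dots> = v \<otimes> (a \<otimes> b)" unfolding av using c by (simp add: m_assoc)
    finally show ?thesis .
  qed
  then show "a \<otimes> b \<in> {c \<in> carrier G. \<forall>v \<in> A. c \<otimes> v = v \<otimes> c}" using a b by auto
qed auto

lemma mem_set_mult_iff: "x \<in> H <#> K \<longleftrightarrow> (\<exists>h \<in> H. \<exists>k \<in> K. x = h \<otimes> k)"
  by (auto simp: set_mult_def)

lemma set_multI: "h \<in> H \<Longrightarrow> k \<in> K \<Longrightarrow> h \<otimes> k \<in> H <#> K"
  by (auto simp: set_mult_def)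

lemma conjugate_set_eq: "g <# H #> inv g = conjugate G g H"
  by (auto simp: conjugate_def l_coset_def r_coset_def)

lemma conjugate_one [simp]:
  assumes "H \<subseteq> carrier G"
  shows "conjugate G \<one> H = H"
  using assms by (force simp: conjugate_def)

lemma finite_subgroups:
  assumes "finite (carrier G)"
  shows "finite {H. subgroup H G}"
  by (rule finite_subset[of _ "Pow (carrier G)"]) (use assms in \<open>auto dest: subgroup.subset\<close>)

lemma finite_normals:
  assumes "finite (carrier G)"
  shows "finite {H. H \<lhd> G}"
  by (rule finite_subset[OF _ finite_subgroups[OF assms]]) (auto dest: normal_imp_subgroup)

lemma conjugate_subgroup:
  assumes "subgroup H G" "g \<in> carrier G"
  shows "subgroup (conjugate G g H) G"
  using subgroup_conjugation_is_surj2[of g H] assms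
  by (simp add: conjugate_set_eq)

lemma normal_iff_conjugate_eq:
  assumes "subgroup H G" "finite (carrier G)"
  shows "H \<lhd> G \<longleftrightarrow> (\<forall>g \<in> carrier G. conjugate G g H = H)"
proof
  assume N: "H \<lhd> G"
  show "\<forall>g \<in> carrier G. conjugate G g H = H"
  proof
    fix g assume g: "g \<in> carrier G"
    show "conjugate G g H = H"
    proof
      show "conjugate G g H \<subseteq> H" using N g by (auto simp: conjugate_def normal_inv_iff)
      show "H \<subseteq> conjugate G g H"
      proof
        fix h assume h: "h \<in> H"
        then have "h \<in> carrier G" using assms by (auto dest: subgroup.subset)
        moreover have "inv g \<otimes> h \<otimes> g \<in> H" using N g h by (simp add: normal.inv_op_closed1)
        ultimately show "h \<in> conjugate G g H"
          using g by (auto intro!: image_eqI[of _ _ "inv g \<otimes> h \<otimes> g"] simp: conjugate_def m_assoc)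
      qed
    qed
  qed
next
  assume "\<forall>g \<in> carrier G. conjugate G g H = H"
  then show "H \<lhd> G" using assms(1) by (auto simp: conjugate_def normal_inv_iff)
qed

lemma subgroup_conj_classes_eq:
  "subgroup_conj_classes G =
     {{conjugate G g H | g. g \<in> carrier G} | H. subgroup H G}"
  unfolding subgroup_conj_classes_def orbits_def orbit_def
  by (intro Collect_cong ex_cong) (auto simp: conjugate_set_eq)

text \<open>Normal subgroups form singleton classes. A nonnormal subgroup has a second conjugate,
  and its class consists of nonnormal subgroups only, so these classes number at most half of the
  nonnormal subgroups.\<close>

lemma mostly_normal_if_d_prime:
  assumes fin: "finite (carrier G)" and d: "d_prime G > 4 / 5"
  shows "mostly_normal G"
proof -
  define cl where "cl H = {conjugate G g H | g. g \<in> carrier G}" for H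
  define N where "N = {H. H \<lhd> G}"
  define A where "A = {H. subgroup H G \<and> \<not> H \<lhd> G}"
  have L: "{H. subgroup H G} = N \<union> A" "N \<inter> A = {}"
    by (auto simp: N_def A_def normal_imp_subgroup)
  have finL: "finite N" "finite A"
    using finite_subgroups[OF fin] L by auto
  have classes: "subgroup_conj_classes G = cl ` N \<union> cl ` A"
    unfolding subgroup_conj_classes_eq cl_def using L(1) by blast
  have self: "H \<in> cl H" if "subgroup H G" for H
    using that conjugate_one[of H] by (auto simp: cl_def dest: subgroup.subset intro!: exI[of _ \<one>])
  have part: "partition {H. subgroup H G} (subgroup_conj_classes G)"
    unfolding subgroup_conj_classes_def
    using group_action.orbit_partition[OF action_by_conjugation_on_subgroups_set] .
  have disj: "C \<inter> D = {}" if "C \<in> cl ` A" "D \<in> cl ` A" "C \<noteq> D" for C D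
    using part that unfolding classes partition_def by blast
  \<comment> \<open>The classes partition the subgroups, so a class with a normal member is the
    class of that member.\<close>
  have clN: "C = {H}" if "H \<in> N" "H \<in> C" "C \<in> subgroup_conj_classes G" for H C
  proof -
    have "C = cl H"
      using part that self[of H] unfolding classes partition_def N_def
      by (smt (verit, ccfv_threshold) Un_iff image_eqI mem_Collect_eq normal_imp_subgroup)
    also have "\<dots> = {H}"
      using that(1) fin normal_iff_conjugate_eq[of H] by (auto simp: cl_def N_def normal_imp_subgroup)
    finally show ?thesis .
  qed
  have sub: "C \<subseteq> A" if C: "C \<in> cl ` A" for C
  proof
    fix K assume K: "K \<in> C"
    then have "subgroup K G" using part C by (auto simp: partition_def classes)
    moreover have "K \<notin> N"
    proof
      assume "K \<in> N"
      then have "C = {K}" using clN K C classes by blast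
      moreover obtain H where "H \<in> A" "C = cl H" using C by auto
      ultimately have "K = H" using self[of H] by (auto simp: A_def)
      then show False using \<open>H \<in> A\<close> \<open>K \<in> N\<close> L by blast
    qed
    ultimately show "K \<in> A" using L(1) by blast
  qed
  have finC: "finite C" if "C \<in> cl ` A" for C
    using sub[OF that] finL by (auto intro: finite_subset)
  have two: "2 \<le> card C" if C: "C \<in> cl ` A" for C
  proof -
    obtain H where H: "H \<in> A" "C = cl H" using C by auto
    then obtain g where g: "g \<in> carrier G" "conjugate G g H \<noteq> H"
      using normal_iff_conjugate_eq[of H] fin by (auto simp: A_def)
    have "{H, conjugate G g H} \<subseteq> C"
      using H g self[of H] by (auto simp: cl_def A_def)
    then have "card {H, conjugate G g H} \<le> card C"
      using sub[OF C] finL by (meson card_mono finite_subset)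
    then show ?thesis using g by simp
  qed
  have "2 * card (cl ` A) \<le> (\<Sum>C \<in> cl ` A. card C)"
    using sum_mono[of "cl ` A" "\<lambda>_. 2" card] two by simp
  also have "\<dots> = card (\<Union> (cl ` A))"
    by (rule card_Union_disjoint[symmetric])
      (use disj finC in \<open>auto simp: pairwise_def disjnt_def\<close>)
  also have "\<dots> \<le> card A" using sub finL by (intro card_mono) auto
  finally have 1: "2 * card (cl ` A) \<le> card A" .
  have "card (subgroup_conj_classes G) \<le> card (cl ` N) + card (cl ` A)"
    unfolding classes by (rule card_Un_le)
  also have "card (cl ` N) \<le> card N" using finL by (simp add: card_image_le)
  finally have 2: "2 * card (subgroup_conj_classes G) \<le> 2 * card N + card A" using 1 by simp
  define c where "c = card (subgroup_conj_classes G)"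
  define n where "n = card N + card A"
  have n: "card (carrier (subgroup_lattice G)) = n"
    unfolding subgroup_lattice_def n_def using L finL by (simp add: card_Un_disjoint)
  have "card N > 0"
    using finL one_is_normal by (auto simp: card_gt_0_iff N_def)
  then have "real n > 0" by (simp add: n_def)
  then have "4 * real n < 5 * real c"
    using d n by (simp add: d_prime_def field_simps flip: c_def)
  then have "4 * n < 5 * c" by linarith
  \<comment> \<open>For k normal and a nonnormal subgroups in c classes, 2c \<le> 2k + a and 4(k +
    a) < 5c give 8k + 8a < 10k + 5a, that is 3a < 2k.\<close>
  then show ?thesis unfolding mostly_normal_def using 2 by (simp add: n_def c_def N_def A_def)
qed

end

section \<open>Maximal subgroups\<close>

context group
begin

lemma conjugate_conjugate:
  assumes "H \<subseteq> carrier G" "g \<in> carrier G" "k \<in> carrier G"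
  shows "conjugate G g (conjugate G k H) = conjugate G (g \<otimes> k) H"
  unfolding conjugate_def image_image
  by (rule image_cong) (use assms in \<open>auto simp: m_assoc inv_mult_group subset_iff\<close>)

lemma conjugate_inv_conjugate:
  assumes "H \<subseteq> carrier G" "g \<in> carrier G"
  shows "conjugate G (inv g) (conjugate G g H) = H"
  using conjugate_conjugate[of H "inv g" g] assms by simp

lemma subgroup_normalizer:
  assumes "A \<subseteq> carrier G"
  shows "subgroup {x \<in> carrier G. conjugate G x A = A} G"
proof (rule subgroupI)
  show "{x \<in> carrier G. conjugate G x A = A} \<noteq> {}"
    using assms by (auto intro!: exI[of _ \<one>])
  show "inv a \<in> {x \<in> carrier G. conjugate G x A = A}"
    if "a \<in> {x \<in> carrier G. conjugate G x A = A}" for a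
    using that conjugate_inv_conjugate[OF assms, of a] by simp
  show "a \<otimes> b \<in> {x \<in> carrier G. conjugate G x A = A}"
    if "a \<in> {x \<in> carrier G. conjugate G x A = A}" "b \<in> {x \<in> carrier G. conjugate G x A = A}" for a b
    using that conjugate_conjugate[OF assms, of a b] by simp
qed auto

lemma conjugate_self:
  assumes "subgroup H G" "g \<in> H"
  shows "conjugate G g H = H"
proof
  have g: "g \<in> carrier G" "inv g \<in> H" using assms by (auto simp: subgroup.mem_carrier subgroup.m_inv_closed)
  show "conjugate G g H \<subseteq> H"
    using assms g by (auto simp: conjugate_def subgroup.m_closed)
  show "H \<subseteq> conjugate G g H"
  proof
    fix h assume h: "h \<in> H"
    then have "h = g \<otimes> (inv g \<otimes> h \<otimes> g) \<otimes> inv g" "inv g \<otimes> h \<otimes> g \<in> H"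
      using assms g by (simp_all add: m_assoc subgroup.mem_carrier subgroup.m_closed)
    then show "h \<in> conjugate G g H" unfolding conjugate_def by blast
  qed
qed

lemma card_conjugate:
  assumes "H \<subseteq> carrier G" "g \<in> carrier G"
  shows "card (conjugate G g H) = card H"
  unfolding conjugate_def by (rule card_image) (use assms in \<open>auto intro!: inj_onI simp: subset_iff\<close>)

lemma normal_conjugateD:
  assumes "conjugate G g H \<lhd> G" "subgroup H G" "g \<in> carrier G" "finite (carrier G)"
  shows "H \<lhd> G"
proof -
  have "conjugate G (inv g) (conjugate G g H) = conjugate G g H"
    using normal_iff_conjugate_eq[OF conjugate_subgroup, of H g] assms inv_closed by blast
  then have "conjugate G g H = H"
    using conjugate_inv_conjugate[of H g] assms by (auto dest: subgroup.subset)
  then show ?thesis using assms by simp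
qed

lemma subset_set_mult_left:
  assumes "subgroup H G" "K \<subseteq> carrier G"
  shows "K \<subseteq> K <#> H"
  using assms by (force simp: set_mult_def dest: subgroup.one_closed)

lemma subset_set_mult_right:
  assumes "subgroup K G" "H \<subseteq> carrier G"
  shows "H \<subseteq> K <#> H"
  using assms by (force simp: set_mult_def dest: subgroup.one_closed)

text \<open>If \<open>M\<close> normalised its conjugate by \<open>g\<close>, the normaliser of that
  conjugate would contain two different subgroups of the same size, one of them maximal, hence be
  everything; then \<open>M\<close> itself would be normal. So some \<open>m\<close> in
  \<open>M\<close> moves this conjugate, and since \<open>m\<close> fixes \<open>M\<close> the
  result is a third one.\<close>

lemma three_conjugates_of_maximal:
  assumes fin: "finite (carrier G)"
    and M: "subgroup M G" "\<not> M \<lhd> G"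
    and max: "\<And>K. subgroup K G \<Longrightarrow> M \<subseteq> K \<Longrightarrow> K = M \<or> K = carrier G"
  obtains g k where "g \<in> carrier G" "k \<in> carrier G"
    "card {M, conjugate G g M, conjugate G k M} = 3"
proof -
  have Mc: "M \<subseteq> carrier G" using M by (simp add: subgroup.subset)
  obtain g where g: "g \<in> carrier G" "conjugate G g M \<noteq> M"
    using M normal_iff_conjugate_eq[OF M(1) fin] by auto
  have "\<exists>m \<in> M. conjugate G m (conjugate G g M) \<noteq> conjugate G g M"
  proof (rule ccontr)
    assume *: "\<not> ?thesis"
    define N where "N = {x \<in> carrier G. conjugate G x (conjugate G g M) = conjugate G g M}"
    have sub: "subgroup (conjugate G g M) G" using conjugate_subgroup[OF M(1) g(1)] by simp
    then have sc: "conjugate G g M \<subseteq> carrier G" by (rule subgroup.subset)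
    have "subgroup N G" unfolding N_def using sc by (rule subgroup_normalizer)
    moreover have "M \<subseteq> N" using * Mc by (auto simp: N_def)
    moreover have "conjugate G g M \<subseteq> N"
    proof
      fix x assume x: "x \<in> conjugate G g M"
      then show "x \<in> N" using sc conjugate_self[OF sub x] by (auto simp: N_def)
    qed
    moreover have "\<not> conjugate G g M \<subseteq> M"
    proof
      assume "conjugate G g M \<subseteq> M"
      moreover have "card (conjugate G g M) = card M"
        using g Mc by (simp add: card_conjugate)
      moreover have "finite M" using Mc fin by (rule finite_subset)
      ultimately show False using g by (simp add: card_subset_eq)
    qed
    ultimately have "N = carrier G" using max by blast
    then have "conjugate G g M \<lhd> G"
      using normal_iff_conjugate_eq[OF sub fin] by (auto simp: N_def)
    then show False using normal_conjugateD[of g M] M g fin by auto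
  qed
  then obtain m where m: "m \<in> M" "conjugate G m (conjugate G g M) \<noteq> conjugate G g M" by blast
  have mc: "m \<in> carrier G" using m Mc by auto
  have mM: "conjugate G m M = M" using conjugate_self[OF M(1) m(1)] .
  have "conjugate G m (conjugate G g M) \<noteq> M"
  proof
    assume "conjugate G m (conjugate G g M) = M"
    then have "conjugate G (inv m) (conjugate G m (conjugate G g M)) = conjugate G (inv m) (conjugate G m M)" using mM by simp
    then have "conjugate G g M = M"
      using conjugate_inv_conjugate[of M m] conjugate_inv_conjugate[of "conjugate G g M" m] mc Mc g(1)
        subgroup.subset[OF conjugate_subgroup[OF M(1) g(1)]]
      by simp
    then show False using g by simp
  qed
  then have "card {M, conjugate G g M, conjugate G (m \<otimes> g) M} = 3"
    using m g conjugate_conjugate[OF Mc, of m g] mc by auto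
  then show ?thesis using that[of g "m \<otimes> g"] g mc by simp
qed

text \<open>
  The normal subgroups above a minimal normal subgroup \<open>V\<close> satisfy \<open>K = V (K \<inter> M)\<close>, so they have
  pairwise disjoint, nonnormal classes of subgroups \<open>U\<close> with \<open>V U = K\<close>; at most two normal subgroups
  do not lie above \<open>V\<close>.
\<close>

lemma not_mostly_normal_if_core_free_maximal:
  assumes fin: "finite (carrier G)"
    and M: "subgroup M G" "\<not> M \<lhd> G"
    and max: "\<And>K. subgroup K G \<Longrightarrow> M \<subseteq> K \<Longrightarrow> K = M \<or> K = carrier G"
    and core: "\<And>K. K \<lhd> G \<Longrightarrow> K \<subseteq> M \<Longrightarrow> K = {\<one>}"
  shows "\<not> mostly_normal G"
proof -
  have Mc: "M \<subseteq> carrier G" using M by (simp add: subgroup.subset)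
  have normc: "K \<subseteq> carrier G" if "K \<lhd> G" for K
    using that by (simp add: normal_imp_subgroup subgroup.subset)
  have Mne: "M \<noteq> carrier G" using M normal_self by auto
  \<comment> \<open>By maximality the product is \<open>M\<close> or the whole group, and the first
    would put \<open>K\<close> inside the trivial core.\<close>
  have KM: "K <#> M = carrier G" if K: "K \<lhd> G" "K \<noteq> {\<one>}" for K
    using max[OF mult_norm_subgroup[OF K(1) M(1)]] subset_set_mult_left[OF M(1) normc[OF K(1)]]
      subset_set_mult_right[OF normal_imp_subgroup[OF K(1)] Mc] core[OF K(1)] K by auto
  have "carrier G \<noteq> {\<one>}" using Mne subgroup.one_closed[OF M(1)] Mc by auto
  then obtain V where V: "V \<lhd> G" "V \<noteq> {\<one>}"
    and Vmin: "\<And>K. K \<lhd> G \<Longrightarrow> K \<noteq> {\<one>} \<Longrightarrow> K \<subseteq> V \<Longrightarrow> K = V"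
  proof -
    have "finite {K. K \<lhd> G \<and> K \<noteq> {\<one>}}" using finite_normals[OF fin] by simp
    moreover have "{K. K \<lhd> G \<and> K \<noteq> {\<one>}} \<noteq> {}"
      using normal_self \<open>carrier G \<noteq> {\<one>}\<close> by blast
    ultimately obtain V where "V \<in> {K. K \<lhd> G \<and> K \<noteq> {\<one>}}"
      "\<And>K. K \<in> {K. K \<lhd> G \<and> K \<noteq> {\<one>}} \<Longrightarrow> K \<subseteq> V \<Longrightarrow> K = V"
      by (metis (no_types, lifting) finite_has_minimal)
    then show ?thesis using that by blast
  qed
  have Vc: "V \<subseteq> carrier G" using normc V by blast
  have VM: "\<exists>v \<in> V. \<exists>m \<in> M. x = v \<otimes> m" if "x \<in> carrier G" for x
    using that KM[OF V] mem_set_mult_iff[of x V M] by simp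
  \<comment> \<open>The centraliser of \<open>V\<close> in \<open>M\<close> is normal, because the
    group is \<open>V <#> M\<close>: conjugation by \<open>V\<close> fixes its elements and
    \<open>M\<close> normalises it. Being contained in \<open>M\<close>, it is trivial.\<close>
  define D where "D = {c \<in> M. \<forall>v \<in> V. c \<otimes> v = v \<otimes> c}"
  have D: "D = {\<one>}"
  proof (rule core)
    show "D \<subseteq> M" by (auto simp: D_def)
    have "D = M \<inter> {c \<in> carrier G. \<forall>v \<in> V. c \<otimes> v = v \<otimes> c}"
      using Mc by (auto simp: D_def)
    then have "subgroup D G"
      using subgroups_Inter_pair[OF M(1) subgroup_centralizer[OF Vc]] by simp
    moreover have "g \<otimes> c \<otimes> inv g \<in> D" if g: "g \<in> carrier G" and c: "c \<in> D" for g c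
    proof -
      obtain v m where vm: "v \<in> V" "m \<in> M" "g = v \<otimes> m" using VM g by blast
      have cc: "c \<in> carrier G" "c \<in> M" "v \<in> carrier G" "m \<in> carrier G"
        using c vm Mc Vc by (auto simp: D_def)
      define d where "d = m \<otimes> c \<otimes> inv m"
      have dc: "d \<in> carrier G" using cc by (simp add: d_def)
      have dM: "d \<in> M" unfolding d_def using cc vm M
        by (simp add: subgroup.m_closed subgroup.m_inv_closed)
      have d: "d \<otimes> w = w \<otimes> d" if w: "w \<in> V" for w
      proof -
        have wc: "w \<in> carrier G" using w Vc by auto
        have "inv m \<otimes> w \<otimes> m \<in> V" using V(1) cc w by (simp add: normal.inv_op_closed1)
        then have *: "c \<otimes> (inv m \<otimes> w \<otimes> m) = inv m \<otimes> w \<otimes> m \<otimes> c" using c by (auto simp: D_def)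
        have "d \<otimes> w = m \<otimes> (c \<otimes> (inv m \<otimes> w \<otimes> m)) \<otimes> inv m"
          using cc wc by (simp add: d_def m_assoc)
        also have "\<dots> = w \<otimes> d" unfolding * using cc wc by (simp add: d_def m_assoc)
        finally show ?thesis .
      qed
      have "g \<otimes> c \<otimes> inv g = v \<otimes> d \<otimes> inv v"
        using cc vm by (simp add: d_def m_assoc inv_mult_group)
      also have "\<dots> = d" using d[OF vm(1), symmetric] cc dc by (simp add: m_assoc)
      finally show ?thesis using d dM by (auto simp: D_def)
    qed
    ultimately show "D \<lhd> G" by (simp add: normal_inv_iff)
  qed
  \<comment> \<open>Normal subgroups meeting \<open>V\<close> trivially centralise \<open>V\<close>.
    For two of them, an element of the second is \<open>k \<otimes> m\<close> with \<open>k\<close>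
    in the first and \<open>m\<close> in \<open>M\<close>; then \<open>m\<close> centralises
    \<open>V\<close> as well, so it lies in \<open>D\<close> and vanishes. This gives inclusions
    both ways, and \<open>E\<close> has at most one member.\<close>
  define E where "E = {K. K \<lhd> G \<and> K \<noteq> {\<one>} \<and> K \<inter> V = {\<one>}}"
  have Esub: "K' \<subseteq> K" if K: "K \<in> E" "K' \<in> E" for K K'
  proof
    fix c assume c: "c \<in> K'"
    have n: "K \<lhd> G" "K' \<lhd> G" "K \<inter> V \<subseteq> {\<one>}" "K' \<inter> V \<subseteq> {\<one>}" "K \<noteq> {\<one>}"
      using K by (auto simp: E_def)
    have cc: "c \<in> carrier G" using c normc n by blast
    then obtain k m where km: "k \<in> K" "m \<in> M" "c = k \<otimes> m"
      using KM[OF n(1,5)] mem_set_mult_iff[of c K M] by auto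
    have kc: "k \<in> carrier G" "m \<in> carrier G" using km normc n Mc by auto
    have "m \<otimes> v = v \<otimes> m" if v: "v \<in> V" for v
    proof -
      have vc: "v \<in> carrier G" using v Vc by auto
      have 1: "c \<otimes> v = v \<otimes> c" "k \<otimes> v = v \<otimes> k"
        using normal_imp_commuting[OF n(2) V(1) n(4) c v] normal_imp_commuting[OF n(1) V(1) n(3) km(1) v] by auto
      have "k \<otimes> (m \<otimes> v) = v \<otimes> k \<otimes> m" using 1(1) km kc vc by (simp add: m_assoc)
      also have "\<dots> = k \<otimes> (v \<otimes> m)" unfolding 1(2)[symmetric] using kc vc by (simp add: m_assoc)
      finally show ?thesis using kc vc by simp
    qed
    then have "m \<in> D" using km by (simp add: D_def)
    then show "c \<in> K" using D km kc by simp
  qed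
  have finN: "finite {H. H \<lhd> G}" using finite_normals[OF fin] .
  have cardE: "card E \<le> 1"
  proof -
    have "finite E" using finN by (simp add: E_def)
    then show ?thesis using Esub card_le_Suc0_iff_eq[of E] by (simp add: set_eq_subset)
  qed
  define A where "A = {K. K \<lhd> G \<and> V \<subseteq> K}"
  have finA: "finite A" and finE: "finite E" using finN by (auto simp: A_def E_def)
  have normals: "{H. H \<lhd> G} \<subseteq> A \<union> {{\<one>}} \<union> E"
  proof
    fix K assume "K \<in> {H. H \<lhd> G}"
    then have K: "K \<lhd> G" by simp
    have "K \<inter> V \<lhd> G" using normal_subgroup_intersect[OF K V(1)] .
    then have "K \<inter> V = {\<one>} \<or> K \<inter> V = V" using Vmin by blast
    then show "K \<in> A \<union> {{\<one>}} \<union> E" using K by (auto simp: A_def E_def)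
  qed
  \<comment> \<open>A subgroup \<open>U\<close> determines \<open>K\<close> as
    \<open>V <#> U\<close>, so the families for different \<open>K\<close> are disjoint and their
    sizes add up.\<close>
  define F where "F K = {U. subgroup U G \<and> \<not> U \<lhd> G \<and> V <#> U = K}" for K
  have finS: "finite {H. subgroup H G \<and> \<not> H \<lhd> G}" using finite_subgroups[OF fin] by auto
  have finF: "finite (F K)" for K
    by (rule finite_subset[OF _ finS]) (auto simp: F_def)
  have Fconj: "conjugate G g U \<in> F K"
    if U: "U \<in> F K" and g: "g \<in> carrier G" and K: "K \<lhd> G" for U g K
  proof -
    have U': "subgroup U G" "\<not> U \<lhd> G" "V <#> U = K" "U \<subseteq> carrier G"
      using U by (auto simp: F_def subgroup.subset)
    have "V <#> conjugate G g U = K"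
    proof
      show "V <#> conjugate G g U \<subseteq> K"
      proof
        fix x assume "x \<in> V <#> conjugate G g U"
        then obtain v u where vu: "v \<in> V" "u \<in> U" "x = v \<otimes> (g \<otimes> u \<otimes> inv g)"
          by (auto simp: set_mult_def conjugate_def)
        have c: "v \<in> carrier G" "u \<in> carrier G" using vu Vc U' by auto
        have "inv g \<otimes> v \<otimes> g \<in> V" using V(1) g vu by (simp add: normal.inv_op_closed1)
        then have "inv g \<otimes> v \<otimes> g \<otimes> u \<in> K" using U'(3) vu by (auto simp: set_mult_def)
        then have "g \<otimes> (inv g \<otimes> v \<otimes> g \<otimes> u) \<otimes> inv g \<in> K"
          using K g by (simp add: normal.inv_op_closed2)
        then show "x \<in> K" using c g vu by (simp add: m_assoc)
      qed
      show "K \<subseteq> V <#> conjugate G g U"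
      proof
        fix k assume k: "k \<in> K"
        then have "inv g \<otimes> k \<otimes> g \<in> V <#> U" using K g U'(3) by (simp add: normal.inv_op_closed1)
        then obtain v u where vu: "v \<in> V" "u \<in> U" "inv g \<otimes> k \<otimes> g = v \<otimes> u"
          by (auto simp: set_mult_def)
        have c: "v \<in> carrier G" "u \<in> carrier G" "k \<in> carrier G" using vu Vc U' k normc K by auto
        have "k = g \<otimes> (inv g \<otimes> k \<otimes> g) \<otimes> inv g" using c g by (simp add: m_assoc)
        also have "\<dots> = (g \<otimes> v \<otimes> inv g) \<otimes> (g \<otimes> u \<otimes> inv g)"
          unfolding vu(3) using c g by (simp add: m_assoc)
        finally show "k \<in> V <#> conjugate G g U"
          using vu V(1) g by (auto simp: mem_set_mult_iff conjugate_def normal.inv_op_closed2)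
      qed
    qed
    then show ?thesis
      using U' g fin normal_conjugateD[of g U] by (auto simp: F_def conjugate_subgroup)
  qed
  \<comment> \<open>By the Dedekind argument \<open>V <#> (K \<inter> M) = K\<close>. If
    \<open>K \<inter> M\<close> were normal it would be trivial and \<open>K\<close> would equal
    \<open>V\<close>; this is why \<open>V\<close> is excluded. A second conjugate provides the
    second member.\<close>
  have F2: "2 \<le> card (F K)" if K: "K \<in> A - {V}" for K
  proof -
    have K': "K \<lhd> G" "V \<subseteq> K" "K \<noteq> V" "subgroup K G" "K \<subseteq> carrier G"
      using K normc by (auto simp: A_def normal_imp_subgroup)
    have dec: "\<exists>v \<in> V. \<exists>m \<in> K \<inter> M. x = v \<otimes> m" if x: "x \<in> K" for x
    proof -
      obtain v m where vm: "v \<in> V" "m \<in> M" "x = v \<otimes> m" using VM x K' by blast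
      then have "m = inv v \<otimes> x" using Vc Mc by (auto simp: subset_iff)
      moreover have "inv v \<otimes> x \<in> K"
        using vm(1) x K'(2,4) by (blast intro: subgroup.m_closed subgroup.m_inv_closed)
      ultimately have "m \<in> K" by simp
      then show ?thesis using vm by blast
    qed
    have U: "subgroup (K \<inter> M) G" using K' M by (simp add: subgroups_Inter_pair)
    have "\<not> K \<inter> M \<lhd> G"
    proof
      assume "K \<inter> M \<lhd> G"
      then have 1: "K \<inter> M = {\<one>}" by (rule core) auto
      have "K \<subseteq> V"
      proof
        fix x assume "x \<in> K"
        then obtain v where "v \<in> V" "x = v \<otimes> \<one>" using dec unfolding 1 by blast
        then show "x \<in> V" using Vc by auto
      qed
      then show False using K' by auto
    qed
    moreover have "V <#> (K \<inter> M) = K"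
    proof
      show "V <#> (K \<inter> M) \<subseteq> K"
        using K'(2) subgroup.m_closed[OF K'(4)] by (auto simp: set_mult_def)
      show "K \<subseteq> V <#> (K \<inter> M)" using dec mem_set_mult_iff[of _ V "K \<inter> M"] by blast
    qed
    ultimately have UF: "K \<inter> M \<in> F K" using U by (auto simp: F_def)
    obtain g where g: "g \<in> carrier G" "conjugate G g (K \<inter> M) \<noteq> K \<inter> M"
      using normal_iff_conjugate_eq[OF U fin] \<open>\<not> K \<inter> M \<lhd> G\<close> by blast
    have "card {K \<inter> M, conjugate G g (K \<inter> M)} \<le> card (F K)"
      using UF Fconj[OF UF g(1) K'(1)] finF by (intro card_mono) auto
    then show ?thesis using g by simp
  qed
  \<comment> \<open>At the top the subgroup in question is \<open>M\<close>, whose third conjugate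
    supplies the extra unit that the final comparison requires.\<close>
  have F3: "3 \<le> card (F (carrier G))"
  proof -
    have MF: "M \<in> F (carrier G)" using M KM[OF V] by (simp add: F_def)
    obtain g k where gk: "g \<in> carrier G" "k \<in> carrier G"
      "card {M, conjugate G g M, conjugate G k M} = 3"
      using three_conjugates_of_maximal[OF fin M max] by blast
    have "card {M, conjugate G g M, conjugate G k M} \<le> card (F (carrier G))"
      using MF Fconj[OF MF _ normal_self] gk(1,2) finF by (intro card_mono) auto
    then show ?thesis using gk by simp
  qed
  have sumF: "(\<Sum>K \<in> B. card (F K)) \<le> card {H. subgroup H G \<and> \<not> H \<lhd> G}" if B: "finite B" for B
  proof -
    have "(\<Sum>K \<in> B. card (F K)) = card (\<Union>K \<in> B. F K)"
      using B finF by (subst card_UN_disjoint) (auto simp: F_def)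
    also have "\<dots> \<le> card {H. subgroup H G \<and> \<not> H \<lhd> G}"
      using finS by (intro card_mono) (auto simp: F_def)
    finally show ?thesis .
  qed
  show ?thesis
  proof (cases "V = carrier G")
    case True
    have "{H. H \<lhd> G} \<subseteq> {{\<one>}, carrier G}"
      using Vmin normc unfolding True by blast
    then have "card {H. H \<lhd> G} \<le> card {{\<one>}, carrier G}" by (intro card_mono) auto
    also have "\<dots> \<le> 2" by (simp add: card_insert_if)
    finally have "card {H. H \<lhd> G} \<le> 2" .
    moreover have "3 \<le> card {H. subgroup H G \<and> \<not> H \<lhd> G}"
      using sumF[of "{carrier G}"] F3 by simp
    ultimately show ?thesis by (simp add: mostly_normal_def)
  next
    case False
    have inA: "V \<in> A" "carrier G \<in> A" using V Vc normal_self by (auto simp: A_def)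
    define B where "B = A - {V} - {carrier G}"
    have A: "A = insert V (insert (carrier G) B)" using inA by (auto simp: B_def)
    have finB: "finite B" "carrier G \<notin> B" "V \<notin> B" using finA by (auto simp: B_def)
    have "2 * card B + 3 \<le> (\<Sum>K \<in> B. card (F K)) + card (F (carrier G))"
      using sum_mono[of B "\<lambda>_. 2" "\<lambda>K. card (F K)"] F2 F3 by (auto simp: B_def)
    also have "\<dots> \<le> card {H. subgroup H G \<and> \<not> H \<lhd> G}"
      using sumF[of "insert (carrier G) B"] finB by simp
    finally have 1: "2 * card B + 3 \<le> card {H. subgroup H G \<and> \<not> H \<lhd> G}" .
    have "card {H. H \<lhd> G} \<le> card (A \<union> {{\<one>}} \<union> E)"
      using normals finA finE by (intro card_mono) auto
    also have "\<dots> \<le> card A + 1 + card E"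
      using card_Un_le[of "A \<union> {{\<one>}}" E] card_Un_le[of A "{{\<one>}}"] by simp
    also have "card A = card B + 2" unfolding A using finB False by simp
    finally have "card {H. H \<lhd> G} \<le> card B + 4" using cardE by simp
    \<comment> \<open>With b normal subgroups strictly between \<open>V\<close> and the group there
      are at least 2b + 3 nonnormal and at most b + 4 normal ones: \<open>V\<close>, the group, the
      trivial subgroup and a possible member of \<open>E\<close> come on top of b. Now 3(2b + 3)
      \<ge> 2(b + 4).\<close>
    then show ?thesis using 1 by (simp add: mostly_normal_def)
  qed
qed

end

section \<open>The normalizer condition\<close>

context group_hom
begin

lemma subgroup_vimage:
  assumes "subgroup U H"
  shows "subgroup {g \<in> carrier G. h g \<in> U} G"
proof (rule G.subgroupI)
  have "\<one> \<in> {g \<in> carrier G. h g \<in> U}" using subgroup.one_closed[OF assms] by simp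
  then show "{g \<in> carrier G. h g \<in> U} \<noteq> {}" by blast
qed (auto simp: subgroup.m_closed[OF assms] subgroup.m_inv_closed[OF assms])

lemma normal_vimage:
  assumes "U \<lhd> H"
  shows "{g \<in> carrier G. h g \<in> U} \<lhd> G"
proof -
  have U: "subgroup U H" "\<forall>x \<in> carrier H. \<forall>u \<in> U. x \<otimes>\<^bsub>H\<^esub> u \<otimes>\<^bsub>H\<^esub> inv\<^bsub>H\<^esub> x \<in> U"
    using assms unfolding H.normal_inv_iff by blast+
  then show ?thesis using subgroup_vimage[OF U(1)] by (simp add: G.normal_inv_iff)
qed

text \<open>With the two preceding lemmas this is the part of the correspondence theorem that is
  used: subgroups of a quotient are handled through their preimages and recovered as images.\<close>

lemma image_vimage:
  assumes "h ` carrier G = carrier H" "subgroup U H"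
  shows "h ` {g \<in> carrier G. h g \<in> U} = U"
proof
  show "U \<subseteq> h ` {g \<in> carrier G. h g \<in> U}"
  proof
    fix u assume u: "u \<in> U"
    then have "u \<in> h ` carrier G" using assms(1) subgroup.subset[OF assms(2)] by blast
    then show "u \<in> h ` {g \<in> carrier G. h g \<in> U}" using u by blast
  qed
qed blast

end

context normal
begin

lemma group_hom_Mod: "group_hom G (G Mod H) (\<lambda>a. H #> a)"
  by (intro group_hom.intro group_hom_axioms.intro is_group factorgroup_is_group r_coset_hom_Mod)

lemma Mod_surj: "(\<lambda>a. H #> a) ` carrier G = carrier (G Mod H)"
  by (simp add: carrier_FactGroup)

lemma rcos_eq_iff:
  assumes "a \<in> carrier G" "b \<in> carrier G"
  shows "H #> a = H #> b \<longleftrightarrow> a \<otimes> inv b \<in> H"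
proof
  assume "H #> a = H #> b"
  then have "a \<in> H #> b" using rcos_self[OF assms(1) is_subgroup] by simp
  then show "a \<otimes> inv b \<in> H" using rcos_module[OF is_group assms(2,1)] by simp
next
  assume "a \<otimes> inv b \<in> H"
  then have "a \<in> H #> b" using rcos_module[OF is_group assms(2,1)] by simp
  then show "H #> a = H #> b" using repr_independence[OF _ assms(2) is_subgroup] by simp
qed

lemma rcos_eq_self_iff:
  assumes "a \<in> carrier G"
  shows "H #> a = H \<longleftrightarrow> a \<in> H"
  using rcos_eq_iff[OF assms one_closed] assms coset_mult_one[OF subset] by simp

lemma rcos_mem_image_iff:
  assumes "subgroup M G" "H \<subseteq> M" "a \<in> carrier G"
  shows "H #> a \<in> (\<lambda>a. H #> a) ` M \<longleftrightarrow> a \<in> M"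
proof
  assume "H #> a \<in> (\<lambda>a. H #> a) ` M"
  then obtain m where m: "m \<in> M" "H #> a = H #> m" by auto
  have mc: "m \<in> carrier G" using m(1) subgroup.subset[OF assms(1)] by blast
  have "a \<otimes> inv m \<in> M" using rcos_eq_iff[OF assms(3) mc] m(2) assms(2) by blast
  then have "a \<otimes> inv m \<otimes> m \<in> M" using m(1) by (rule subgroup.m_closed[OF assms(1)])
  then show "a \<in> M" using mc assms(3) by (simp add: m_assoc)
qed blast

lemma finite_Mod:
  assumes "finite (carrier G)"
  shows "finite (carrier (G Mod H))"
  using assms by (simp add: carrier_FactGroup)

end

context group
begin

text \<open>Dividing by the core turns a nonnormal maximal subgroup into a core-free one, which is
  again maximal and nonnormal by correspondence. The count for the core-free case then refutes
  \<open>mn\<close>.\<close>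

lemma maximal_subgroup_normal:
  assumes fin: "finite (carrier G)"
    and mn: "\<And>R. R \<lhd> G \<Longrightarrow> mostly_normal (G Mod R)"
    and M: "subgroup M G"
    and max: "\<And>K. subgroup K G \<Longrightarrow> M \<subseteq> K \<Longrightarrow> K = M \<or> K = carrier G"
  shows "M \<lhd> G"
proof (rule ccontr)
  assume nM: "\<not> M \<lhd> G"
  \<comment> \<open>The core is obtained as a maximal element. Comparison with larger subgroups only
    is sufficient, because preimages under the quotient map contain \<open>R\<close>.\<close>
  have "finite {R. R \<lhd> G \<and> R \<subseteq> M}" using finite_normals[OF fin] by simp
  moreover have "{\<one>} \<in> {R. R \<lhd> G \<and> R \<subseteq> M}"
    using one_is_normal subgroup.one_closed[OF M] by simp
  ultimately obtain R where "R \<in> {R. R \<lhd> G \<and> R \<subseteq> M}"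
    "\<And>K. K \<in> {R. R \<lhd> G \<and> R \<subseteq> M} \<Longrightarrow> R \<subseteq> K \<Longrightarrow> K = R"
    by (metis (no_types, lifting) empty_iff finite_has_maximal)
  then have R: "R \<lhd> G" "R \<subseteq> M" and Rmax: "\<And>K. K \<lhd> G \<Longrightarrow> K \<subseteq> M \<Longrightarrow> R \<subseteq> K \<Longrightarrow> K = R" by auto
  interpret R: normal R G using R(1) .
  interpret h: group_hom G "G Mod R" "\<lambda>a. R #> a" by (rule R.group_hom_Mod)
  define M' where "M' = (\<lambda>a. R #> a) ` M"
  have M': "subgroup M' (G Mod R)" unfolding M'_def using h.subgroup_img_is_subgroup[OF M] .
  have vM: "{g \<in> carrier G. R #> g \<in> M'} = M"
    using R.rcos_mem_image_iff[OF M R(2)] subgroup.subset[OF M] by (auto simp: M'_def)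
  have "\<not> mostly_normal (G Mod R)"
  proof (rule group.not_mostly_normal_if_core_free_maximal[OF R.factorgroup_is_group R.finite_Mod[OF fin] M'])
    show "\<not> M' \<lhd> G Mod R" using h.normal_vimage[of M'] nM vM by auto
    show "K = M' \<or> K = carrier (G Mod R)" if K: "subgroup K (G Mod R)" "M' \<subseteq> K" for K
    proof -
      have "M \<subseteq> {g \<in> carrier G. R #> g \<in> K}" using K vM by auto
      then have "{g \<in> carrier G. R #> g \<in> K} = M \<or> {g \<in> carrier G. R #> g \<in> K} = carrier G"
        by (rule max[OF h.subgroup_vimage[OF K(1)]])
      then show ?thesis
        using h.image_vimage[OF R.Mod_surj K(1)] R.Mod_surj by (auto simp: M'_def)
    qed
    show "K = {\<one>\<^bsub>G Mod R\<^esub>}" if K: "K \<lhd> G Mod R" "K \<subseteq> M'" for K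
    proof -
      have sub: "subgroup K (G Mod R)" using K by (simp add: normal_imp_subgroup)
      have "{g \<in> carrier G. R #> g \<in> K} = R"
      proof (rule Rmax[OF h.normal_vimage[OF K(1)]])
        show "{g \<in> carrier G. R #> g \<in> K} \<subseteq> M" using K vM by auto
        show "R \<subseteq> {g \<in> carrier G. R #> g \<in> K}"
        proof
          fix r assume r: "r \<in> R"
          have "R \<in> K" using subgroup.one_closed[OF sub] by simp
          then show "r \<in> {g \<in> carrier G. R #> g \<in> K}"
            using r R.subset R.rcos_eq_self_iff[of r] by auto
        qed
      qed
      then have "K = (\<lambda>a. R #> a) ` R" using h.image_vimage[OF R.Mod_surj sub] by simp
      also have "\<dots> = (\<lambda>_. R) ` R"
        using R.rcos_eq_self_iff R.subset by (intro image_cong) auto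
      also have "\<dots> = {R}" by (rule image_constant[OF subgroup.one_closed[OF R.is_subgroup]])
      finally show ?thesis by simp
    qed
  qed
  then show False using mn R by blast
qed

text \<open>A smallest subgroup \<open>C\<close> of \<open>B\<close> properly above \<open>A\<close>
  has \<open>A\<close> as a maximal subgroup. So \<open>A\<close> is normal in \<open>C\<close>, and
  every element of \<open>C - A\<close> is a witness.\<close>

lemma normalizer_condition_if_mostly_normal:
  assumes fin: "finite (carrier G)"
    and mn: "\<And>H R. subgroup H G \<Longrightarrow> R \<lhd> G\<lparr>carrier := H\<rparr> \<Longrightarrow> mostly_normal (G\<lparr>carrier := H\<rparr> Mod R)"
  shows "normalizer_condition G"
  unfolding normalizer_condition_def
proof (intro allI impI)
  fix A B assume A: "subgroup A G" and B: "subgroup B G" and AB: "A \<subset> B"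
  have "finite {C. subgroup C G \<and> A \<subset> C \<and> C \<subseteq> B}" using finite_subgroups[OF fin] by simp
  moreover have "B \<in> {C. subgroup C G \<and> A \<subset> C \<and> C \<subseteq> B}" using A B AB by auto
  ultimately obtain C where C0: "C \<in> {C. subgroup C G \<and> A \<subset> C \<and> C \<subseteq> B}"
    and Cmin0: "\<And>K. K \<in> {C. subgroup C G \<and> A \<subset> C \<and> C \<subseteq> B} \<Longrightarrow> K \<subseteq> C \<Longrightarrow> K = C"
    by (metis (no_types, lifting) empty_iff finite_has_minimal)
  then have C: "subgroup C G" "A \<subset> C" "C \<subseteq> B" by auto
  have Cmin: "K = C" if "subgroup K G" "A \<subset> K" "K \<subseteq> C" for K
    using Cmin0[of K] that C(3) by blast
  have gC: "group (G\<lparr>carrier := C\<rparr>)" using C(1) by (rule subgroup_imp_group)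
  have "A \<lhd> G\<lparr>carrier := C\<rparr>"
  proof (rule group.maximal_subgroup_normal[OF gC])
    show "finite (carrier (G\<lparr>carrier := C\<rparr>))"
      using fin subgroup.subset[OF C(1)] by (auto intro: finite_subset)
    show "subgroup A (G\<lparr>carrier := C\<rparr>)" using A C by (auto intro: subgroup_incl)
    fix K assume K: "subgroup K (G\<lparr>carrier := C\<rparr>)" "A \<subseteq> K"
    then have KC: "subgroup K G" "K \<subseteq> C" using incl_subgroup[OF C(1)] subgroup.subset[OF K(1)] by auto
    then show "K = A \<or> K = carrier (G\<lparr>carrier := C\<rparr>)" using Cmin[OF KC(1) _ KC(2)] K(2) by auto
  qed (use mn[OF C(1)] in auto)
  moreover obtain g where g: "g \<in> C" "g \<notin> A" using C by auto
  ultimately have "\<forall>x \<in> A. g \<otimes> x \<otimes> inv g \<in> A"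
    using normal.inv_op_closed2[of A "G\<lparr>carrier := C\<rparr>" g] m_inv_consistent[OF C(1)] by auto
  then show "\<exists>g \<in> B - A. \<forall>x \<in> A. g \<otimes> x \<otimes> inv g \<in> A" using g C by auto
qed

lemma normalizer_condition_subgroup:
  assumes "normalizer_condition G" "subgroup H G"
  shows "normalizer_condition (G\<lparr>carrier := H\<rparr>)"
  unfolding normalizer_condition_def
proof (intro allI impI)
  fix A B assume A: "subgroup A (G\<lparr>carrier := H\<rparr>)" and B: "subgroup B (G\<lparr>carrier := H\<rparr>)" and AB: "A \<subset> B"
  then obtain g where g: "g \<in> B - A" "\<forall>x \<in> A. g \<otimes> x \<otimes> inv g \<in> A"
    using assms incl_subgroup[OF assms(2)] unfolding normalizer_condition_def by meson
  then show "\<exists>g\<in>B - A. \<forall>x\<in>A. g \<otimes>\<^bsub>G\<lparr>carrier := H\<rparr>\<^esub> x \<otimes>\<^bsub>G\<lparr>carrier := H\<rparr>\<^esub> inv\<^bsub>G\<lparr>carrier := H\<rparr>\<^esub> g \<in> A"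
    using m_inv_consistent[OF assms(2)] subgroup.subset[OF B] by (intro bexI[of _ g]) auto
qed

lemma normalizer_condition_Mod:
  assumes "normalizer_condition G" "N \<lhd> G"
  shows "normalizer_condition (G Mod N)"
  unfolding normalizer_condition_def
proof (intro allI impI)
  interpret N: normal N G by fact
  interpret h: group_hom G "G Mod N" "\<lambda>a. N #> a" by (rule N.group_hom_Mod)
  fix A B assume A: "subgroup A (G Mod N)" and B: "subgroup B (G Mod N)" and AB: "A \<subset> B"
  define A' where "A' = {g \<in> carrier G. N #> g \<in> A}"
  define B' where "B' = {g \<in> carrier G. N #> g \<in> B}"
  have im: "(\<lambda>a. N #> a) ` A' = A" "(\<lambda>a. N #> a) ` B' = B"
    unfolding A'_def B'_def using h.image_vimage[OF N.Mod_surj] A B by blast+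
  have "A' \<subseteq> B'" using AB by (auto simp: A'_def B'_def)
  moreover have "A' \<noteq> B'" using AB im by auto
  ultimately have "A' \<subset> B'" by simp
  then obtain g where g: "g \<in> B' - A'" "\<forall>x \<in> A'. g \<otimes> x \<otimes> inv g \<in> A'"
    using assms(1) h.subgroup_vimage[OF A] h.subgroup_vimage[OF B]
    unfolding normalizer_condition_def A'_def[symmetric] B'_def[symmetric] by meson
  have gc: "g \<in> carrier G" using g by (auto simp: B'_def)
  show "\<exists>g\<in>B - A. \<forall>x\<in>A. g \<otimes>\<^bsub>G Mod N\<^esub> x \<otimes>\<^bsub>G Mod N\<^esub> inv\<^bsub>G Mod N\<^esub> g \<in> A"
  proof (intro bexI[of _ "N #> g"] ballI)
    show "N #> g \<in> B - A" using g by (auto simp: A'_def B'_def)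
    fix x assume "x \<in> A"
    then obtain a where a: "a \<in> A'" "x = N #> a" using im by auto
    then have "N #> (g \<otimes> a \<otimes> inv g) \<in> A" using g by (auto simp: A'_def)
    moreover have "a \<in> carrier G" using a by (auto simp: A'_def)
    ultimately show "(N #> g) \<otimes>\<^bsub>G Mod N\<^esub> x \<otimes>\<^bsub>G Mod N\<^esub> inv\<^bsub>G Mod N\<^esub> (N #> g) \<in> A"
      using gc a(2) h.hom_mult[of "g \<otimes> a" "inv g"] h.hom_mult[of g a] h.hom_inv[of g] by simp
  qed
qed

section \<open>Central elements from the normalizer condition\<close>

lemma subgroup_set_mult_normalizing:
  assumes A: "subgroup A G" and B: "subgroup B G"
    and norm: "\<And>a b. a \<in> A \<Longrightarrow> b \<in> B \<Longrightarrow> b \<otimes> a \<otimes> inv b \<in> A"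
  shows "subgroup (A <#> B) G"
proof (rule subgroupI)
  have c: "A \<subseteq> carrier G" "B \<subseteq> carrier G" using A B by (simp_all add: subgroup.subset)
  show "A <#> B \<subseteq> carrier G" using c by (rule setmult_subset_G)
  show "A <#> B \<noteq> {}" using A B by (auto simp: set_mult_def dest: subgroup.one_closed)
  fix x assume "x \<in> A <#> B"
  then obtain a b where ab: "a \<in> A" "b \<in> B" "x = a \<otimes> b" by (auto simp: mem_set_mult_iff)
  have abc: "a \<in> carrier G" "b \<in> carrier G" "inv a \<in> A" "inv b \<in> B"
    using ab c A B by (auto simp: subgroup.m_inv_closed)
  have "inv x = (inv b \<otimes> inv a \<otimes> inv (inv b)) \<otimes> inv b"
    using abc ab(3) by (simp add: m_assoc inv_mult_group)
  then show "inv x \<in> A <#> B" using norm[OF abc(3,4)] abc(4) by (auto simp: mem_set_mult_iff)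
  fix y assume "y \<in> A <#> B"
  then obtain a' b' where ab': "a' \<in> A" "b' \<in> B" "y = a' \<otimes> b'" by (auto simp: mem_set_mult_iff)
  have abc': "a' \<in> carrier G" "b' \<in> carrier G" using ab' c by auto
  have "x \<otimes> y = (a \<otimes> (b \<otimes> a' \<otimes> inv b)) \<otimes> (b \<otimes> b')"
    using abc abc' ab(3) ab'(3) by (simp add: m_assoc)
  moreover have "a \<otimes> (b \<otimes> a' \<otimes> inv b) \<in> A" "b \<otimes> b' \<in> B"
    using ab ab' norm A B by (auto simp: subgroup.m_closed)
  ultimately show "x \<otimes> y \<in> A <#> B" by (auto simp: mem_set_mult_iff)
qed

lemma generate_singleton_commute:
  assumes "g \<in> carrier G" "x \<in> generate G {g}"
  shows "x \<in> carrier G" "x \<otimes> g = g \<otimes> x"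
  using generate_subgroup_incl[OF _ subgroup_centralizer[of "{g}"], of "{g}"] assms by auto

text \<open>
  Let \<open>A\<close> be the centre of a maximal subgroup \<open>M\<close>, and let \<open>g\<close> normalise \<open>M\<close> without lying in it.
  If no nontrivial element of \<open>A\<close> commuted with \<open>g\<close>, then \<open>\<langle>g\<rangle>\<close> would be self-normalising in
  \<open>A \<langle>g\<rangle>\<close>.
\<close>

lemma nontrivial_central_element_subgroup:
  assumes fin: "finite (carrier G)" and nc: "normalizer_condition G"
  shows "subgroup H G \<Longrightarrow> H \<noteq> {\<one>} \<Longrightarrow> \<exists>z \<in> H. z \<noteq> \<one> \<and> (\<forall>x \<in> H. z \<otimes> x = x \<otimes> z)"
proof (induction "card H" arbitrary: H rule: less_induct)
  case less
  have Hc: "H \<subseteq> carrier G" using less.prems by (simp add: subgroup.subset)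
  have finH: "finite H" using Hc fin by (rule finite_subset)
  have "finite {M. subgroup M G \<and> M \<subset> H}" using finite_subgroups[OF fin] by simp
  moreover have "{\<one>} \<in> {M. subgroup M G \<and> M \<subset> H}"
    using triv_subgroup subgroup.one_closed[OF less.prems(1)] less.prems(2) by auto
  ultimately obtain M where "M \<in> {M. subgroup M G \<and> M \<subset> H}"
    "\<And>K. K \<in> {M. subgroup M G \<and> M \<subset> H} \<Longrightarrow> M \<subseteq> K \<Longrightarrow> K = M"
    by (metis (no_types, lifting) empty_iff finite_has_maximal)
  then have M: "subgroup M G" "M \<subset> H"
    and Mmax: "\<And>K. subgroup K G \<Longrightarrow> K \<subset> H \<Longrightarrow> M \<subseteq> K \<Longrightarrow> K = M" by auto
  have Mc: "M \<subseteq> carrier G" using M Hc by auto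
  obtain g where g: "g \<in> H" "g \<notin> M" and gM: "\<forall>x \<in> M. g \<otimes> x \<otimes> inv g \<in> M"
    using nc M less.prems unfolding normalizer_condition_def by blast
  have gc: "g \<in> carrier G" using g Hc by auto
  have conj: "conjugate G g M = M"
  proof (rule card_subset_eq)
    show "conjugate G g M \<subseteq> M" using gM by (auto simp: conjugate_def)
    show "finite M" using Mc fin by (rule finite_subset)
    show "card (conjugate G g M) = card M" using Mc gc by (rule card_conjugate)
  qed
  \<comment> \<open>By maximality \<open>H\<close> is generated by \<open>M\<close> and
    \<open>g\<close>, so it is enough to find a nontrivial element that commutes with
    \<open>M\<close> and with \<open>g\<close>.\<close>
  have gen: "H \<subseteq> K" if K: "subgroup K G" "M \<subseteq> K" "g \<in> K" for K
  proof (rule ccontr)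
    assume "\<not> H \<subseteq> K"
    then have "H \<inter> K = M"
      using K M by (intro Mmax subgroups_Inter_pair less.prems) auto
    then show False using K g by auto
  qed
  have central: "\<exists>z \<in> H. z \<noteq> \<one> \<and> (\<forall>x \<in> H. z \<otimes> x = x \<otimes> z)"
    if a: "a \<in> H" "a \<noteq> \<one>" "\<forall>m \<in> M. a \<otimes> m = m \<otimes> a" "a \<otimes> g = g \<otimes> a" for a
  proof -
    have "H \<subseteq> {c \<in> carrier G. \<forall>v \<in> {a}. c \<otimes> v = v \<otimes> c}"
      by (rule gen[OF subgroup_centralizer]) (use a Hc Mc gc in auto)
    then show ?thesis using a by force
  qed
  show ?case
  proof (cases "M = {\<one>}")
    case True
    show ?thesis by (rule central[of g]) (use True g gc in auto)
  next
    case False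
    have "card M < card H" using M finH by (simp add: psubset_card_mono)
    then obtain z where z: "z \<in> M" "z \<noteq> \<one>" "\<forall>x \<in> M. z \<otimes> x = x \<otimes> z"
      using less.hyps[OF _ M(1) False] by blast
    define A where "A = M \<inter> {c \<in> carrier G. \<forall>v \<in> M. c \<otimes> v = v \<otimes> c}"
    have A: "subgroup A G" unfolding A_def
      by (rule subgroups_Inter_pair[OF M(1) subgroup_centralizer[OF Mc]])
    have Ac: "A \<subseteq> carrier G" by (auto simp: A_def)
    have zA: "z \<in> A" using z Mc by (auto simp: A_def)
    show ?thesis
    proof (rule ccontr)
      assume no: "\<not> ?thesis"
      have fix_g: "a = \<one>" if "a \<in> A" "a \<otimes> g = g \<otimes> a" for a
        using central[of a] that no M by (auto simp: A_def)
      define C where "C = generate G {g}"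
      have C: "subgroup C G" "g \<in> C" using gc
        by (auto simp: C_def generate_is_subgroup generate.incl)
      have gA: "g \<otimes> a \<otimes> inv g \<in> A" if a: "a \<in> A" for a
      proof -
        have ac: "a \<in> carrier G" using a Ac by auto
        have "g \<otimes> a \<otimes> inv g \<otimes> m = m \<otimes> (g \<otimes> a \<otimes> inv g)" if m: "m \<in> M" for m
        proof -
          obtain m' where m': "m' \<in> M" "m = g \<otimes> m' \<otimes> inv g"
            using m conj by (auto simp: conjugate_def)
          have m'c: "m' \<in> carrier G" using m' Mc by auto
          have am: "a \<otimes> m' = m' \<otimes> a" using a m' by (auto simp: A_def)
          have "g \<otimes> a \<otimes> inv g \<otimes> m = g \<otimes> (a \<otimes> m') \<otimes> inv g"
            using ac m'c gc m'(2) by (simp add: m_assoc)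
          also have "\<dots> = m \<otimes> (g \<otimes> a \<otimes> inv g)"
            unfolding am using ac m'c gc m'(2) by (simp add: m_assoc)
          finally show ?thesis .
        qed
        then show ?thesis using a ac gc gM by (auto simp: A_def)
      qed
      have "conjugate G g A = A"
      proof (rule card_subset_eq)
        show "conjugate G g A \<subseteq> A" using gA by (auto simp: conjugate_def)
        show "finite A" using Ac fin by (rule finite_subset)
        show "card (conjugate G g A) = card A" using Ac gc by (rule card_conjugate)
      qed
      then have "C \<subseteq> {x \<in> carrier G. conjugate G x A = A}"
        unfolding C_def using gc
        by (intro generate_subgroup_incl[OF _ subgroup_normalizer[OF Ac]]) auto
      then have CA: "x \<otimes> a \<otimes> inv x \<in> A" if "a \<in> A" "x \<in> C" for a x
        using that by (auto simp: conjugate_def)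
      have B: "subgroup (A <#> C) G" by (rule subgroup_set_mult_normalizing[OF A C(1) CA])
      have "C \<subseteq> A <#> C" using subset_set_mult_right[OF A subgroup.subset[OF C(1)]] .
      \<comment> \<open>Elements of \<open>C\<close> commute with \<open>g\<close>, and in
        \<open>A\<close> only the identity does; the central element \<open>z\<close> of
        \<open>M\<close> separates the two groups.\<close>
      moreover have "\<not> A \<subseteq> C"
        using fix_g[OF zA] z generate_singleton_commute[OF gc] zA by (auto simp: C_def)
      then have "C \<noteq> A <#> C" using subset_set_mult_left[OF C(1) Ac] by auto
      ultimately obtain b where b: "b \<in> A <#> C" "b \<notin> C" "\<forall>x \<in> C. b \<otimes> x \<otimes> inv b \<in> C"
        using nc C(1) B unfolding normalizer_condition_def by blast
      then obtain a x where ax: "a \<in> A" "x \<in> C" "b = a \<otimes> x" by (auto simp: mem_set_mult_iff)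
      have c: "a \<in> carrier G" "x \<in> carrier G" using ax Ac subgroup.subset[OF C(1)] by auto
      have xg: "x \<otimes> g = g \<otimes> x" using generate_singleton_commute gc ax by (simp add: C_def)
      \<comment> \<open>The factor \<open>x\<close> of \<open>b\<close> is a power of
        \<open>g\<close>, so \<open>a\<close> alone already conjugates \<open>g\<close> into
        \<open>C\<close>. The commutator of \<open>a\<close> and \<open>g\<close> then lies in
        \<open>C\<close> and, as \<open>g\<close> normalises \<open>A\<close>, also in
        \<open>A\<close>; hence it is trivial, and so is \<open>a\<close>.\<close>
      have "b \<otimes> g \<otimes> inv b = a \<otimes> (x \<otimes> g) \<otimes> inv x \<otimes> inv a"
        using ax(3) c gc by (simp add: m_assoc inv_mult_group)
      also have "\<dots> = a \<otimes> g \<otimes> inv a" unfolding xg using c gc by (simp add: m_assoc)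
      finally have "a \<otimes> g \<otimes> inv a \<in> C" using b C by metis
      then have 1: "a \<otimes> g \<otimes> inv a \<otimes> inv g \<in> C"
        using C by (simp add: subgroup.m_closed subgroup.m_inv_closed)
      have "a \<otimes> (g \<otimes> inv a \<otimes> inv g) \<in> A"
        using gA ax A by (simp add: subgroup.m_closed subgroup.m_inv_closed)
      then have "a \<otimes> g \<otimes> inv a \<otimes> inv g \<in> A" using c gc by (simp add: m_assoc)
      then have "a \<otimes> g \<otimes> inv a \<otimes> inv g = \<one>"
        using fix_g generate_singleton_commute[OF gc] 1 by (auto simp: C_def)
      then have "a \<otimes> g \<otimes> inv a \<otimes> inv g \<otimes> (g \<otimes> a) = g \<otimes> a" using c gc by simp
      then have "a \<otimes> g = g \<otimes> a" using c gc by (simp add: m_assoc)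
      then have "a = \<one>" using fix_g ax by blast
      then show False using ax b c by simp
    qed
  qed
qed

lemma nontrivial_central_element:
  assumes "finite (carrier G)" "normalizer_condition G" "carrier G \<noteq> {\<one>}"
  obtains z where "z \<in> carrier G" "z \<noteq> \<one>" "\<And>x. x \<in> carrier G \<Longrightarrow> z \<otimes> x = x \<otimes> z"
  using nontrivial_central_element_subgroup[OF assms(1,2) subgroup_self assms(3)] by blast

end

section \<open>Nilpotency and modularity\<close>

context group
begin

lemma normal_center: "{c \<in> carrier G. \<forall>v \<in> carrier G. c \<otimes> v = v \<otimes> c} \<lhd> G"
  unfolding normal_inv_iff
proof (intro conjI ballI)
  show "subgroup {c \<in> carrier G. \<forall>v \<in> carrier G. c \<otimes> v = v \<otimes> c} G"
    by (rule subgroup_centralizer) simp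
  fix x c assume x: "x \<in> carrier G" and c: "c \<in> {c \<in> carrier G. \<forall>v \<in> carrier G. c \<otimes> v = v \<otimes> c}"
  then have "x \<otimes> c \<otimes> inv x = c \<otimes> x \<otimes> inv x" by simp
  also have "\<dots> = c" using x c by (simp add: m_assoc)
  finally show "x \<otimes> c \<otimes> inv x \<in> {c \<in> carrier G. \<forall>v \<in> carrier G. c \<otimes> v = v \<otimes> c}" using c by simp
qed

text \<open>\<open>Z\<close> is the preimage of the centre of the quotient by \<open>N\<close>. The
  conclusion is phrased with commutators so that it matches the generators of the lower central
  series.\<close>

lemma central_above_normal:
  assumes fin: "finite (carrier G)" and nc: "normalizer_condition G"
    and N: "N \<lhd> G" "N \<noteq> carrier G"
  obtains Z where "Z \<lhd> G" "N \<subset> Z"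
    "\<And>z y. z \<in> Z \<Longrightarrow> y \<in> carrier G \<Longrightarrow> z \<otimes> y \<otimes> inv z \<otimes> inv y \<in> N"
proof -
  interpret N: normal N G using N(1) .
  interpret h: group_hom G "G Mod N" "\<lambda>a. N #> a" by (rule N.group_hom_Mod)
  define U where "U = {c \<in> carrier (G Mod N). \<forall>v \<in> carrier (G Mod N). c \<otimes>\<^bsub>G Mod N\<^esub> v = v \<otimes>\<^bsub>G Mod N\<^esub> c}"
  have U: "U \<lhd> G Mod N" unfolding U_def by (rule h.H.normal_center)
  define Z where "Z = {g \<in> carrier G. N #> g \<in> U}"
  have "carrier (G Mod N) \<noteq> {\<one>\<^bsub>G Mod N\<^esub>}"
  proof
    assume *: "carrier (G Mod N) = {\<one>\<^bsub>G Mod N\<^esub>}"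
    have "g \<in> N" if "g \<in> carrier G" for g
      using that * N.rcos_eq_self_iff[OF that] N.Mod_surj by auto
    then show False using N N.subset by auto
  qed
  then obtain c where c: "c \<in> carrier (G Mod N)" "c \<noteq> \<one>\<^bsub>G Mod N\<^esub>"
    "\<And>v. v \<in> carrier (G Mod N) \<Longrightarrow> c \<otimes>\<^bsub>G Mod N\<^esub> v = v \<otimes>\<^bsub>G Mod N\<^esub> c"
    using h.H.nontrivial_central_element[OF N.finite_Mod[OF fin] normalizer_condition_Mod[OF nc N(1)]]
    by blast
  then obtain g where g: "g \<in> carrier G" "c = N #> g"
    unfolding N.Mod_surj[symmetric] by blast
  have "g \<in> Z" using c g by (auto simp: Z_def U_def)
  moreover have "g \<notin> N" using c(2) g N.rcos_eq_self_iff[OF g(1)] by simp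
  moreover have "N \<subseteq> Z"
  proof
    fix n assume n: "n \<in> N"
    then have "N #> n = \<one>\<^bsub>G Mod N\<^esub>" using N.subset N.rcos_eq_self_iff[of n] by auto
    moreover have "\<one>\<^bsub>G Mod N\<^esub> \<in> U"
      by (rule subgroup.one_closed[OF normal_imp_subgroup[OF U]])
    ultimately show "n \<in> Z" using n N.subset by (auto simp: Z_def)
  qed
  ultimately have "N \<subset> Z" by auto
  moreover have "z \<otimes> y \<otimes> inv z \<otimes> inv y \<in> N" if z: "z \<in> Z" and y: "y \<in> carrier G" for z y
  proof -
    have zc: "z \<in> carrier G" using z by (simp add: Z_def)
    have "N #> y \<in> carrier (G Mod N)" using y by simp
    then have "(N #> z) \<otimes>\<^bsub>G Mod N\<^esub> (N #> y) = (N #> y) \<otimes>\<^bsub>G Mod N\<^esub> (N #> z)"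
      using z by (simp add: Z_def U_def)
    then have "N #> (z \<otimes> y) = N #> (y \<otimes> z)" using h.hom_mult zc y by metis
    then show ?thesis
      using N.rcos_eq_iff[of "z \<otimes> y" "y \<otimes> z"] zc y by (simp add: m_assoc inv_mult_group)
  qed
  ultimately show ?thesis using that[OF h.normal_vimage[OF U]] by (simp add: Z_def)
qed

text \<open>Take a smallest normal \<open>K\<close> above some term of the lower central series. If
  it is nontrivial, choose a largest normal \<open>N\<close> not containing it. The preimage of the
  centre modulo \<open>N\<close> is larger than \<open>N\<close> and so contains \<open>K\<close>.
  Commutators of \<open>K\<close> with the group then fall into \<open>K \<inter> N\<close>, which
  contains the next term and is smaller than \<open>K\<close>.\<close>

lemma nilpotent_group_if_normalizer_condition:
  assumes fin: "finite (carrier G)" and nc: "normalizer_condition G"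
  shows "nilpotent_group G"
proof
  have "finite {K. K \<lhd> G \<and> (\<exists>n. lower_central G n \<subseteq> K)}" using finite_normals[OF fin] by simp
  moreover have "carrier G \<in> {K. K \<lhd> G \<and> (\<exists>n. lower_central G n \<subseteq> K)}"
    using normal_self by (auto intro: exI[of _ 0])
  ultimately obtain K where K0: "K \<in> {K. K \<lhd> G \<and> (\<exists>n. lower_central G n \<subseteq> K)}"
    and Kmin: "\<And>L. L \<in> {K. K \<lhd> G \<and> (\<exists>n. lower_central G n \<subseteq> K)} \<Longrightarrow> L \<subseteq> K \<Longrightarrow> L = K"
    by (metis (no_types, lifting) empty_iff finite_has_minimal)
  obtain n where n: "lower_central G n \<subseteq> K" and K: "K \<lhd> G" using K0 by auto
  have Kc: "K \<subseteq> carrier G" using K by (simp add: normal_imp_subgroup subgroup.subset)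
  have "K = {\<one>}"
  proof (rule ccontr)
    assume K1: "K \<noteq> {\<one>}"
    have "finite {N. N \<lhd> G \<and> \<not> K \<subseteq> N}" using finite_normals[OF fin] by simp
    moreover have "{\<one>} \<in> {N. N \<lhd> G \<and> \<not> K \<subseteq> N}"
      using one_is_normal K1 subgroup.one_closed[OF normal_imp_subgroup[OF K]] by blast
    ultimately obtain N where N0: "N \<in> {N. N \<lhd> G \<and> \<not> K \<subseteq> N}"
      and Nmax: "\<And>L. L \<in> {N. N \<lhd> G \<and> \<not> K \<subseteq> N} \<Longrightarrow> N \<subseteq> L \<Longrightarrow> L = N"
      by (metis (no_types, lifting) empty_iff finite_has_maximal)
    have N: "N \<lhd> G" "\<not> K \<subseteq> N" "N \<noteq> carrier G" using N0 Kc by auto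
    obtain Z where Z: "Z \<lhd> G" "N \<subset> Z"
      "\<And>z y. z \<in> Z \<Longrightarrow> y \<in> carrier G \<Longrightarrow> z \<otimes> y \<otimes> inv z \<otimes> inv y \<in> N"
      using central_above_normal[OF fin nc N(1,3)] by blast
    have KZ: "K \<subseteq> Z" using Nmax[of Z] Z by auto
    have comm: "x \<otimes> y \<otimes> inv x \<otimes> inv y \<in> K \<inter> N" if x: "x \<in> lower_central G n" and y: "y \<in> carrier G" for x y
    proof
      have xK: "x \<in> K" using x n by auto
      show "x \<otimes> y \<otimes> inv x \<otimes> inv y \<in> N" using Z(3) xK KZ y by auto
      have "y \<otimes> inv x \<otimes> inv y \<in> K"
        using K xK y by (simp add: normal.inv_op_closed2 normal_imp_subgroup subgroup.m_inv_closed)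
      then have "x \<otimes> (y \<otimes> inv x \<otimes> inv y) \<in> K"
        using K xK by (simp add: normal_imp_subgroup subgroup.m_closed)
      then show "x \<otimes> y \<otimes> inv x \<otimes> inv y \<in> K" using xK Kc y by (simp add: m_assoc subset_iff)
    qed
    have KN: "K \<inter> N \<lhd> G" using K N(1) by (rule normal_subgroup_intersect)
    have "lower_central G (Suc n) \<subseteq> K \<inter> N"
      unfolding lower_central.simps
      by (rule generate_subgroup_incl[OF _ normal_imp_subgroup[OF KN]]) (use comm in blast)
    then have "K \<inter> N \<in> {K. K \<lhd> G \<and> (\<exists>n. lower_central G n \<subseteq> K)}" using KN by blast
    then have "K \<inter> N = K" by (rule Kmin) simp
    then show False using N by auto
  qed
  moreover have "\<one> \<in> lower_central G n" by (cases n) (auto intro: generate.one)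
  ultimately have "lower_central G n = {\<one>}" using n by auto
  then show "\<exists>n. lower_central G n = {\<one>}" ..
qed

section \<open>Modularity from permuting subgroups\<close>

lemma subgroup_set_mult_commute:
  assumes A: "subgroup A G" and B: "subgroup B G" and AB: "A <#> B = B <#> A"
  shows "subgroup (A <#> B) G"
proof (rule subgroupI)
  have c: "A \<subseteq> carrier G" "B \<subseteq> carrier G" using A B by (simp_all add: subgroup.subset)
  show "A <#> B \<subseteq> carrier G" using c by (rule setmult_subset_G)
  show "A <#> B \<noteq> {}" using A B by (auto simp: set_mult_def dest: subgroup.one_closed)
  fix x assume "x \<in> A <#> B"
  then obtain a b where ab: "a \<in> A" "b \<in> B" "x = a \<otimes> b" by (auto simp: mem_set_mult_iff)
  have abc: "a \<in> carrier G" "b \<in> carrier G" using ab c by auto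
  have "inv x = inv b \<otimes> inv a" using abc ab(3) by (simp add: inv_mult_group)
  then have "inv x \<in> B <#> A"
    using set_multI[of "inv b" B "inv a" A] ab A B by (simp add: subgroup.m_inv_closed)
  then show "inv x \<in> A <#> B" using AB by simp
  fix y assume "y \<in> A <#> B"
  then obtain a' b' where ab': "a' \<in> A" "b' \<in> B" "y = a' \<otimes> b'" by (auto simp: mem_set_mult_iff)
  have abc': "a' \<in> carrier G" "b' \<in> carrier G" using ab' c by auto
  have "b \<otimes> a' \<in> A <#> B" unfolding AB using ab ab' by (auto simp: mem_set_mult_iff)
  then obtain a2 b2 where ab2: "a2 \<in> A" "b2 \<in> B" "b \<otimes> a' = a2 \<otimes> b2" by (auto simp: mem_set_mult_iff)
  have abc2: "a2 \<in> carrier G" "b2 \<in> carrier G" using ab2 c by auto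
  have "x \<otimes> y = a \<otimes> (b \<otimes> a') \<otimes> b'" using abc abc' ab(3) ab'(3) by (simp add: m_assoc)
  also have "\<dots> = (a \<otimes> a2) \<otimes> (b2 \<otimes> b')" unfolding ab2(3) using abc abc' abc2 by (simp add: m_assoc)
  finally show "x \<otimes> y \<in> A <#> B"
    using set_multI[of "a \<otimes> a2" A "b2 \<otimes> b'" B] ab ab' ab2 A B by (simp add: subgroup.m_closed)
qed

text \<open>This is Dedekind's law. An element of the join of \<open>A\<close> and \<open>B\<close>
  is \<open>a \<otimes> b\<close>; if it lies in \<open>C\<close> above \<open>A\<close>, then
  \<open>b\<close> lies in \<open>B \<inter> C\<close>. Permutability is needed only to bound this
  join by the product set; the other join merely has to contain both of its arguments.\<close>

lemma modular_lattice_if_permutable: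
  assumes perm: "\<And>A B. subgroup A G \<Longrightarrow> subgroup B G \<Longrightarrow> A <#> B = B <#> A"
  shows "modular_lattice (subgroup_lattice G)"
proof -
  interpret complete_lattice "subgroup_lattice G"
    unfolding subgroup_lattice_def by (rule subgroups_complete_lattice)
  have car: "carrier (subgroup_lattice G) = {H. subgroup H G}"
    and le: "\<And>A B. A \<sqsubseteq>\<^bsub>subgroup_lattice G\<^esub> B \<longleftrightarrow> A \<subseteq> B"
    by (simp_all add: subgroup_lattice_def)
  show ?thesis
  proof
    fix A B C
    assume ABC: "A \<in> carrier (subgroup_lattice G)" "B \<in> carrier (subgroup_lattice G)"
      "C \<in> carrier (subgroup_lattice G)" and AC: "A \<sqsubseteq>\<^bsub>subgroup_lattice G\<^esub> C"
    let ?L = "subgroup_lattice G"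
    have sub: "subgroup A G" "subgroup B G" "subgroup C G" using ABC by (auto simp: car)
    have c: "A \<subseteq> carrier G" "B \<subseteq> carrier G" "C \<subseteq> carrier G"
      using sub by (simp_all add: subgroup.subset)
    have "A \<squnion>\<^bsub>?L\<^esub> (B \<sqinter>\<^bsub>?L\<^esub> C) \<sqsubseteq>\<^bsub>?L\<^esub> (A \<squnion>\<^bsub>?L\<^esub> B) \<sqinter>\<^bsub>?L\<^esub> C"
    proof (intro meet_le join_le join_closed meet_closed ABC AC)
      show "A \<sqsubseteq>\<^bsub>?L\<^esub> A \<squnion>\<^bsub>?L\<^esub> B" using ABC by (simp add: join_left)
      have "B \<sqinter>\<^bsub>?L\<^esub> C \<sqsubseteq>\<^bsub>?L\<^esub> B" using ABC by (simp add: meet_left)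
      moreover have "B \<sqsubseteq>\<^bsub>?L\<^esub> A \<squnion>\<^bsub>?L\<^esub> B" using ABC by (simp add: join_right)
      ultimately show "B \<sqinter>\<^bsub>?L\<^esub> C \<sqsubseteq>\<^bsub>?L\<^esub> A \<squnion>\<^bsub>?L\<^esub> B" by (simp add: le)
      show "B \<sqinter>\<^bsub>?L\<^esub> C \<sqsubseteq>\<^bsub>?L\<^esub> C" using ABC by (simp add: meet_right)
    qed
    moreover have "(A \<squnion>\<^bsub>?L\<^esub> B) \<sqinter>\<^bsub>?L\<^esub> C \<sqsubseteq>\<^bsub>?L\<^esub> A \<squnion>\<^bsub>?L\<^esub> (B \<sqinter>\<^bsub>?L\<^esub> C)"
      unfolding le
    proof
      fix x assume x: "x \<in> (A \<squnion>\<^bsub>?L\<^esub> B) \<sqinter>\<^bsub>?L\<^esub> C"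
      have "(A \<squnion>\<^bsub>?L\<^esub> B) \<sqinter>\<^bsub>?L\<^esub> C \<subseteq> A \<squnion>\<^bsub>?L\<^esub> B" "(A \<squnion>\<^bsub>?L\<^esub> B) \<sqinter>\<^bsub>?L\<^esub> C \<subseteq> C"
        using ABC meet_left[of "A \<squnion>\<^bsub>?L\<^esub> B" C] meet_right[of "A \<squnion>\<^bsub>?L\<^esub> B" C]
        by (simp_all add: le)
      moreover have "A <#> B \<in> carrier ?L"
        unfolding car using subgroup_set_mult_commute[OF sub(1,2) perm[OF sub(1,2)]] by simp
      then have "A \<squnion>\<^bsub>?L\<^esub> B \<subseteq> A <#> B"
        using ABC subset_set_mult_left[OF sub(2) c(1)] subset_set_mult_right[OF sub(1) c(2)]
        unfolding le[symmetric] by (intro join_le) auto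
      ultimately have "x \<in> A <#> B" "x \<in> C" using x by auto
      then obtain a b where ab: "a \<in> A" "b \<in> B" "x = a \<otimes> b" by (auto simp: mem_set_mult_iff)
      have abc: "a \<in> carrier G" "b \<in> carrier G" using ab c by auto
      have "inv a \<otimes> x \<in> C"
        using ab(1) AC \<open>x \<in> C\<close> sub(3) by (auto simp: le subset_iff subgroup.m_closed subgroup.m_inv_closed)
      then have "b \<in> C" using ab(3) abc by simp
      moreover have BC: "B \<inter> C \<in> carrier ?L" using sub subgroups_Inter_pair by (simp add: car)
      then have "B \<inter> C \<subseteq> B \<sqinter>\<^bsub>?L\<^esub> C"
        using ABC meet_le[of "B \<inter> C" B C] by (simp add: le)
      moreover have "B \<sqinter>\<^bsub>?L\<^esub> C \<subseteq> A \<squnion>\<^bsub>?L\<^esub> (B \<sqinter>\<^bsub>?L\<^esub> C)" "A \<subseteq> A \<squnion>\<^bsub>?L\<^esub> (B \<sqinter>\<^bsub>?L\<^esub> C)"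
        using ABC join_left[of A "B \<sqinter>\<^bsub>?L\<^esub> C"] join_right[of A "B \<sqinter>\<^bsub>?L\<^esub> C"] by (simp_all add: le)
      moreover have "subgroup (A \<squnion>\<^bsub>?L\<^esub> (B \<sqinter>\<^bsub>?L\<^esub> C)) G"
        using ABC join_closed[of A "B \<sqinter>\<^bsub>?L\<^esub> C"] meet_closed[of B C] by (simp add: car)
      ultimately show "x \<in> A \<squnion>\<^bsub>?L\<^esub> (B \<sqinter>\<^bsub>?L\<^esub> C)"
        using ab by (auto intro: subgroup.m_closed)
    qed
    ultimately show "A \<squnion>\<^bsub>?L\<^esub> (B \<sqinter>\<^bsub>?L\<^esub> C) = (A \<squnion>\<^bsub>?L\<^esub> B) \<sqinter>\<^bsub>?L\<^esub> C"
      by (simp add: le)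
  qed
qed

lemma permutable_if_cyclic_permutable:
  assumes cyc: "\<And>x y. x \<in> carrier G \<Longrightarrow> y \<in> carrier G \<Longrightarrow>
      generate G {x} <#> generate G {y} = generate G {y} <#> generate G {x}"
    and A: "subgroup A G" and B: "subgroup B G"
  shows "A <#> B = B <#> A"
proof -
  have "A <#> B \<subseteq> B <#> A" if A: "subgroup A G" and B: "subgroup B G" for A B
  proof
    fix x assume "x \<in> A <#> B"
    then obtain a b where ab: "a \<in> A" "b \<in> B" "x = a \<otimes> b" by (auto simp: mem_set_mult_iff)
    have abc: "a \<in> carrier G" "b \<in> carrier G"
      using ab A B by (auto dest: subgroup.subset)
    have "x \<in> generate G {a} <#> generate G {b}"
      using ab(3) by (auto simp: mem_set_mult_iff intro: generate.incl)
    then have "x \<in> generate G {b} <#> generate G {a}" using cyc abc by simp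
    moreover have "generate G {b} \<subseteq> B" "generate G {a} \<subseteq> A"
      using ab A B by (simp_all add: generate_subgroup_incl)
    ultimately show "x \<in> B <#> A" using mono_set_mult by blast
  qed
  then show ?thesis using A B by blast
qed

end

section \<open>Groups generated by two elements of prime order\<close>

context group
begin

text \<open>By Bezout \<open>a\<close> is a product of integer powers of the two given elements.
  Both uses have a prime as the exponent \<open>j\<close>.\<close>

lemma coprime_pow_mem:
  assumes K: "subgroup K G" and a: "a \<in> carrier G" and i: "a [^] (i::nat) \<in> K" and j: "a [^] (j::nat) \<in> K"
    and c: "coprime i j"
  shows "a \<in> K"
proof -
  obtain u v where uv: "u * int i + v * int j = 1"
    using bezout_int[of "int i" "int j"] c by (auto simp: coprime_iff_gcd_eq_1)
  have "a [^] (int i * u) \<in> K" "a [^] (int j * v) \<in> K"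
    using subgroup_int_pow_closed[OF K i, of u] subgroup_int_pow_closed[OF K j, of v] a
    by (simp_all add: int_pow_pow flip: int_pow_int)
  then have "a [^] (int i * u + int j * v) \<in> K"
    using a K by (simp add: int_pow_mult subgroup.m_closed)
  moreover have "int i * u + int j * v = 1" using uv by (simp add: mult.commute)
  ultimately show ?thesis using a by simp
qed

lemma prime_power_one_imp_ord:
  assumes "a \<in> carrier G" "a \<noteq> \<one>" "Factorial_Ring.prime p" "a [^] (p::nat) = \<one>"
  shows "ord a = p"
proof -
  have "ord a dvd p" using assms pow_eq_id by blast
  moreover have "ord a \<noteq> 1" using assms ord_eq_1 by blast
  ultimately show ?thesis using assms(3) prime_nat_iff by blast
qed

lemma card_set_mult_disjoint:
  assumes A: "subgroup A G" and B: "subgroup B G" and AB: "A \<inter> B \<subseteq> {\<one>}"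
  shows "card (A <#> B) = card A * card B"
proof -
  have "inj_on (\<lambda>(a, b). a \<otimes> b) (A \<times> B)"
  proof (rule inj_onI, clarify)
    fix a b a' b' assume ab: "a \<in> A" "b \<in> B" "a' \<in> A" "b' \<in> B" and eq: "a \<otimes> b = a' \<otimes> b'"
    have c: "a \<in> carrier G" "b \<in> carrier G" "a' \<in> carrier G" "b' \<in> carrier G"
      using ab A B by (auto dest: subgroup.subset)
    have "inv a' \<otimes> a = inv a' \<otimes> (a \<otimes> b) \<otimes> inv b" using c by (simp add: m_assoc)
    also have "\<dots> = b' \<otimes> inv b" unfolding eq using c by (simp add: m_assoc)
    finally have *: "inv a' \<otimes> a = b' \<otimes> inv b" .
    have "inv a' \<otimes> a \<in> A" using ab A by (simp add: subgroup.m_closed subgroup.m_inv_closed)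
    moreover have "b' \<otimes> inv b \<in> B" using ab B by (simp add: subgroup.m_closed subgroup.m_inv_closed)
    ultimately have "inv a' \<otimes> a = \<one>" "b' \<otimes> inv b = \<one>" using * AB by auto
    then have "a' \<otimes> (inv a' \<otimes> a) = a'" "b' \<otimes> inv b \<otimes> b = b" using c by simp_all
    then show "a = a' \<and> b = b'" using c by (simp add: m_assoc)
  qed
  moreover have "A <#> B = (\<lambda>(a, b). a \<otimes> b) ` (A \<times> B)" by (auto simp: set_mult_def)
  ultimately show ?thesis by (simp add: card_image card_cartesian_product)
qed

text \<open>The hypothesis says that \<open>z\<close> is the commutator of \<open>a\<close> and
  \<open>b\<close>. Since it is central, each of the \<open>i\<close> factors \<open>a\<close> that
  moves past \<open>b\<close> contributes one \<open>z\<close>.\<close>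

lemma pow_commutator:
  assumes a: "a \<in> carrier G" "b \<in> carrier G" "z \<in> carrier G"
    and z: "\<And>v. v \<in> carrier G \<Longrightarrow> z \<otimes> v = v \<otimes> z" and ab: "a \<otimes> b = z \<otimes> (b \<otimes> a)"
  shows "a [^] (i::nat) \<otimes> b = z [^] i \<otimes> (b \<otimes> a [^] i)"
proof (induction i)
  case 0
  then show ?case using a by simp
next
  case (Suc i)
  have "a [^] Suc i \<otimes> b = a [^] i \<otimes> z \<otimes> (b \<otimes> a)" using a ab by (simp add: m_assoc)
  also have "\<dots> = z \<otimes> (a [^] i \<otimes> b) \<otimes> a" using a z[of "a [^] i"] by (simp flip: m_assoc)
  also have "\<dots> = z [^] Suc i \<otimes> (b \<otimes> a [^] Suc i)"
    unfolding Suc using a z[of "z [^] i"] by (simp flip: m_assoc)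
  finally show ?case .
qed

text \<open>
  Such a group has order \<open>p\<^sup>3\<close>, with \<open>z = [x, y]\<close> central. Apart from the trivial subgroup, its normal subgroups contain
  \<open>\<langle>z\<rangle>\<close>, and there are at most \<open>p + 3\<close> of those, while the \<open>2 p\<close> subgroups
  \<open>\<langle>z\<^sup>k x\<rangle>\<close> and \<open>\<langle>z\<^sup>k y\<rangle>\<close> are not normal. For \<open>p = 2\<close> the group is
  dihedral of order 8 and the estimate is sharp.
\<close>

lemma not_mostly_normal_two_generators:
  fixes p q :: nat
  assumes fin: "finite (carrier G)" and xy: "x \<in> carrier G" "y \<in> carrier G"
    and gen: "generate G {x, y} = carrier G"
    and pq: "Factorial_Ring.prime p" "Factorial_Ring.prime q" and xp: "x [^] p = \<one>" and yq: "y [^] q = \<one>"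
    and noncomm: "x \<otimes> y \<otimes> inv x \<otimes> inv y \<noteq> \<one>"
    and min: "\<And>K. K \<lhd> G \<Longrightarrow> K \<noteq> {\<one>} \<Longrightarrow> x \<otimes> y \<otimes> inv x \<otimes> inv y \<in> K"
    and cen: "c \<in> carrier G" "c \<noteq> \<one>" "\<And>v. v \<in> carrier G \<Longrightarrow> c \<otimes> v = v \<otimes> c"
  shows "\<not> mostly_normal G"
proof -
  define z where "z = x \<otimes> y \<otimes> inv x \<otimes> inv y"
  have zc: "z \<in> carrier G" "z \<noteq> \<one>" using xy noncomm by (simp_all add: z_def)
  have zmin: "z \<in> K" if "K \<lhd> G" "K \<noteq> {\<one>}" for K using min that by (simp add: z_def)
  \<comment> \<open>The centre is a normal subgroup, nontrivial because of \<open>c\<close>, so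
    \<open>min\<close> places the commutator in it.\<close>
  have "z \<in> {c \<in> carrier G. \<forall>v \<in> carrier G. c \<otimes> v = v \<otimes> c}"
    by (rule zmin[OF normal_center]) (use cen in blast)
  then have zcen: "z \<otimes> v = v \<otimes> z" if "v \<in> carrier G" for v using that by simp
  have xyz: "x \<otimes> y = z \<otimes> (y \<otimes> x)" using xy by (simp add: z_def m_assoc)
  have "inv z \<otimes> (x \<otimes> y) = y \<otimes> x" unfolding xyz using xy zc by simp
  then have yxz: "y \<otimes> x = inv z \<otimes> (x \<otimes> y)" by simp
  have izcen: "inv z \<otimes> v = v \<otimes> inv z" if v: "v \<in> carrier G" for v
  proof -
    have "inv z \<otimes> v = inv z \<otimes> (v \<otimes> z) \<otimes> inv z" using v zc by (simp add: m_assoc)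
    also have "\<dots> = v \<otimes> inv z" unfolding zcen[OF v, symmetric] using v zc by (simp add: m_assoc)
    finally show ?thesis .
  qed
  have xpow: "x [^] i \<otimes> y = z [^] i \<otimes> (y \<otimes> x [^] i)" for i :: nat
    using pow_commutator[OF xy zc(1) zcen xyz] .
  have ypow: "y [^] i \<otimes> x = inv z [^] i \<otimes> (x \<otimes> y [^] i)" for i :: nat
    using pow_commutator[OF xy(2,1) inv_closed[OF zc(1)] izcen yxz] .
  have cancel: "a = \<one>" if "v = a \<otimes> v" "a \<in> carrier G" "v \<in> carrier G" for a v
  proof -
    have "\<one> \<otimes> v = a \<otimes> v" using that by simp
    then show ?thesis using that(2,3) one_closed by (metis r_cancel)
  qed
  \<comment> \<open>Setting \<open>i = p\<close> in \<open>xpow\<close> gives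
    \<open>z [^] p = \<one>\<close>; in the same way \<open>y [^] q = \<one>\<close> kills the
    \<open>q\<close>-th power of \<open>inv z\<close>. The order of \<open>z\<close> is therefore
    both primes, and they agree.\<close>
  have "y = z [^] p \<otimes> y" using xpow[of p] xp xy zc by simp
  then have "z [^] p = \<one>" by (rule cancel) (use xy zc in auto)
  then have ordz: "ord z = p" using prime_power_one_imp_ord zc pq by blast
  have "x = inv z [^] q \<otimes> x" using ypow[of q] yq xy zc by simp
  then have "inv z [^] q = \<one>" by (rule cancel) (use xy zc in auto)
  then have "ord (inv z) = q" using prime_power_one_imp_ord[of "inv z" q] zc pq by simp
  then have qp: "q = p" using ordz zc by simp
  then have yp: "y [^] p = \<one>" using yq by simp
  have zpow: "z [^] i = \<one> \<longleftrightarrow> p dvd i" for i :: nat using pow_eq_id[OF zc(1)] ordz by simp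
  have notcomm: "x \<otimes> y \<noteq> y \<otimes> x"
  proof
    assume "x \<otimes> y = y \<otimes> x"
    then have "y \<otimes> x = z \<otimes> (y \<otimes> x)" using xyz by simp
    then have "z = \<one>" by (rule cancel) (use xy zc in auto)
    then show False using zc by simp
  qed
  have "x \<noteq> \<one>" "y \<noteq> \<one>" using notcomm xy by auto
  then have ordxy: "ord x = p" "ord y = p" using prime_power_one_imp_ord xy xp yp pq by auto
  define W where "W = generate G {z}"
  have W: "subgroup W G" "z \<in> W" using zc by (auto simp: W_def generate_is_subgroup generate.incl)
  have cardW: "card W = p" using generate_pow_card[OF zc(1)] ordz by (simp add: W_def)
  have Wcen: "w \<otimes> v = v \<otimes> w" if "w \<in> W" "v \<in> carrier G" for w v
    using generate_subgroup_incl[OF _ subgroup_centralizer[of "carrier G"], of "{z}"] that zc zcen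
    by (auto simp: W_def)
  have Wsub: "W \<subseteq> K" if "subgroup K G" "z \<in> K" for K
    unfolding W_def using that by (simp add: generate_subgroup_incl)
  have gx: "generate G {x} = {x [^] i | i. i \<in> (UNIV :: nat set)}"
    and gy: "generate G {y} = {y [^] i | i. i \<in> (UNIV :: nat set)}"
    using generate_pow_on_finite_carrier[OF fin] xy by blast+
  have gz: "W = {z [^] i | i. i \<in> (UNIV :: nat set)}"
    unfolding W_def using generate_pow_on_finite_carrier[OF fin zc(1)] .
  have sx: "subgroup (generate G {x}) G" and sy: "subgroup (generate G {y}) G"
    using xy by (simp_all add: generate_is_subgroup)
  \<comment> \<open>The order is built up in two disjoint products, first with \<langle>x\<rangle>
    and then with \<langle>y\<rangle>. A power of \<open>x\<close> in \<open>W\<close> commutes with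
    \<open>y\<close>, and a power of \<open>y\<close> in \<open>A\<close> commutes with
    \<open>x\<close>; either way a power of \<open>z\<close> vanishes and the exponent is a multiple
    of \<open>p\<close>.\<close>
  define A where "A = W <#> generate G {x}"
  have A: "subgroup A G" unfolding A_def
  proof (rule subgroup_set_mult_normalizing[OF W(1) sx])
    fix w u assume w: "w \<in> W" and u: "u \<in> generate G {x}"
    have c: "w \<in> carrier G" "u \<in> carrier G" using w u W sx by (auto dest: subgroup.subset)
    have "u \<otimes> w \<otimes> inv u = w \<otimes> u \<otimes> inv u" using Wcen[OF w c(2)] by simp
    also have "\<dots> = w" using c by (simp add: m_assoc)
    finally show "u \<otimes> w \<otimes> inv u \<in> W" using w by simp
  qed
  have Ac: "A \<subseteq> carrier G" using A by (rule subgroup.subset)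
  have WA: "W \<subseteq> A" unfolding A_def
    using subset_set_mult_left[OF sx subgroup.subset[OF W(1)]] .
  have xA: "generate G {x} \<subseteq> A" unfolding A_def
    using subset_set_mult_right[OF W(1) subgroup.subset[OF sx]] .
  have yA: "conjugate G y A = A"
  proof (rule card_subset_eq)
    show "finite A" using Ac fin by (rule finite_subset)
    show "card (conjugate G y A) = card A" using Ac xy by (simp add: card_conjugate)
    show "conjugate G y A \<subseteq> A"
    proof
      fix b assume "b \<in> conjugate G y A"
      then obtain a where a: "a \<in> A" "b = y \<otimes> a \<otimes> inv y" by (auto simp: conjugate_def)
      then obtain w i where w: "w \<in> W" "a = w \<otimes> x [^] (i::nat)"
        unfolding A_def mem_set_mult_iff gx by blast
      have wc: "w \<in> carrier G" using w W by (auto dest: subgroup.subset)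
      define t where "t = z [^] i"
      define u where "u = x [^] i"
      have tu: "t \<in> carrier G" "u \<in> carrier G" "t \<in> W" "u \<in> generate G {x}"
        using zc xy by (auto simp: t_def u_def gz gx)
      have "y \<otimes> u \<otimes> inv y = inv t \<otimes> (t \<otimes> (y \<otimes> u)) \<otimes> inv y" using tu xy by simp
      also have "\<dots> = inv t \<otimes> u" unfolding xpow[of i, folded t_def u_def, symmetric]
        using tu xy by (simp add: m_assoc)
      finally have *: "y \<otimes> u \<otimes> inv y = inv t \<otimes> u" .
      have "b = (y \<otimes> w) \<otimes> u \<otimes> inv y" using a(2) w(2) tu wc xy by (simp add: m_assoc u_def)
      also have "\<dots> = w \<otimes> (y \<otimes> u \<otimes> inv y)"
        unfolding Wcen[OF w(1) xy(2), symmetric] using tu wc xy by (simp add: m_assoc)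
      also have "\<dots> = (w \<otimes> inv t) \<otimes> u" unfolding * using tu wc by (simp add: m_assoc)
      finally show "b \<in> A" unfolding A_def
        using set_multI[of "w \<otimes> inv t" W u "generate G {x}"] w(1) tu W(1)
        by (simp add: subgroup.m_closed subgroup.m_inv_closed)
    qed
  qed
  have "generate G {y} \<subseteq> {g \<in> carrier G. conjugate G g A = A}"
    using xy yA by (intro generate_subgroup_incl[OF _ subgroup_normalizer[OF Ac]]) auto
  then have "\<And>a b. a \<in> A \<Longrightarrow> b \<in> generate G {y} \<Longrightarrow> b \<otimes> a \<otimes> inv b \<in> A"
    by (auto simp: conjugate_def)
  then have B: "subgroup (A <#> generate G {y}) G"
    by (rule subgroup_set_mult_normalizing[OF A sy])
  have "A \<subseteq> A <#> generate G {y}" "generate G {y} \<subseteq> A <#> generate G {y}"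
    using subset_set_mult_left[OF sy Ac] subset_set_mult_right[OF A subgroup.subset[OF sy]] by auto
  then have "{x, y} \<subseteq> A <#> generate G {y}"
    using xA generate.incl[of x "{x}" G] generate.incl[of y "{y}" G] by blast
  then have carB: "carrier G = A <#> generate G {y}"
    using generate_subgroup_incl[OF _ B, of "{x, y}"] gen subgroup.subset[OF B] by blast
  have "W \<inter> generate G {x} \<subseteq> {\<one>}"
  proof
    fix w assume w: "w \<in> W \<inter> generate G {x}"
    then obtain i where i: "w = x [^] (i::nat)" by (auto simp: gx)
    have "w \<otimes> y = z [^] i \<otimes> (w \<otimes> y)" using xpow[of i] Wcen[of w y] w i xy by simp
    then have "z [^] i = \<one>" by (rule cancel) (use i xy zc in auto)
    then show "w \<in> {\<one>}" using zpow pow_eq_id[of x i] ordxy xy i by simp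
  qed
  then have cardA: "card A = p * p"
    unfolding A_def using card_set_mult_disjoint[OF W(1) sx] cardW generate_pow_card[OF xy(1)] ordxy by simp
  have "A \<inter> generate G {y} \<subseteq> {\<one>}"
  proof
    fix a assume a: "a \<in> A \<inter> generate G {y}"
    then obtain i where i: "a = y [^] (i::nat)" by (auto simp: gy)
    obtain w u where wu: "w \<in> W" "u \<in> generate G {x}" "a = w \<otimes> u"
      using a by (auto simp: A_def mem_set_mult_iff)
    have c: "w \<in> carrier G" "u \<in> carrier G" using wu W sx by (auto dest: subgroup.subset)
    have "a \<otimes> x = w \<otimes> (x \<otimes> u)"
      using wu c xy generate_singleton_commute[OF xy(1) wu(2)] by (simp add: m_assoc)
    also have "\<dots> = w \<otimes> x \<otimes> u" using c xy by (simp add: m_assoc)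
    also have "\<dots> = x \<otimes> a" unfolding Wcen[OF wu(1) xy(1)] using wu c xy by (simp add: m_assoc)
    finally have "x \<otimes> a = inv z [^] i \<otimes> (x \<otimes> a)" using ypow[of i] i by simp
    then have "inv z [^] i = \<one>" by (rule cancel) (use i xy zc in auto)
    then have "p dvd i" using pow_eq_id[of "inv z" i] zc ordz by simp
    then show "a \<in> {\<one>}" using pow_eq_id[of y i] ordxy xy i by simp
  qed
  then have ordG: "card (carrier G) = p ^ 3"
    unfolding carB using card_set_mult_disjoint[OF A sy] cardA generate_pow_card[OF xy(2)] ordxy
    by (simp add: power3_eq_cube)
  have p2: "2 \<le> p" using pq by (simp add: prime_ge_2_nat)
  have lag: "\<exists>k \<le> 3. card U = p ^ k" if U: "subgroup U G" for U
  proof -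
    have "card U dvd p ^ 3" using lagrange[OF U] ordG by (metis dvd_triv_right order_def)
    then show ?thesis using divides_primepow_nat[OF pq(1)] by blast
  qed
  \<comment> \<open>These subgroups have order p^2 and meet pairwise in \<open>W\<close>, so the
    sets \<open>U - W\<close> are disjoint in the complement of \<open>W\<close>. Their number is at
    most (p^3 - p)/(p^2 - p) = p + 1.\<close>
  define F where "F = {U. subgroup U G \<and> W \<subset> U \<and> U \<noteq> carrier G}"
  have finF: "finite F" using finite_subgroups[OF fin] by (simp add: F_def)
  have finU: "finite U" if "subgroup U G" for U
    using subgroup.subset[OF that] fin by (rule finite_subset)
  have cardF: "card U = p ^ 2" if U: "U \<in> F" for U
  proof -
    have sU: "subgroup U G" "W \<subset> U" "U \<subset> carrier G"
      using U by (auto simp: F_def dest: subgroup.subset)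
    have "p ^ 1 < card U" using psubset_card_mono[OF finU[OF sU(1)] sU(2)] cardW by simp
    moreover have "card U < p ^ 3" using psubset_card_mono[OF fin sU(3)] ordG by simp
    moreover obtain k where "card U = p ^ k" using lag[OF sU(1)] by blast
    ultimately have "card U = p ^ k" "1 < k" "k < 3"
      using p2 power_strict_increasing_iff[of p] by (metis Suc_1 Suc_le_lessD)+
    then show ?thesis by (simp add: numeral_3_eq_3 numeral_2_eq_2 less_Suc_eq)
  qed
  have interF: "U \<inter> U' = W" if U: "U \<in> F" "U' \<in> F" "U \<noteq> U'" for U U'
  proof (rule ccontr)
    assume ne: "U \<inter> U' \<noteq> W"
    have sU: "subgroup U G" "W \<subset> U" "subgroup U' G" "W \<subset> U'" using U by (auto simp: F_def)
    have sI: "subgroup (U \<inter> U') G" using sU by (simp add: subgroups_Inter_pair)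
    have "W \<subset> U \<inter> U'" using ne sU by auto
    moreover have "U \<inter> U' \<noteq> carrier G" using U by (auto simp: F_def dest: subgroup.subset)
    ultimately have "U \<inter> U' \<in> F" using sI by (simp add: F_def)
    then have "card (U \<inter> U') = card U" "card (U \<inter> U') = card U'" using cardF U by auto
    then have "U \<inter> U' = U" "U \<inter> U' = U'"
      using card_subset_eq[OF finU[OF sU(1)], of "U \<inter> U'"] card_subset_eq[OF finU[OF sU(3)], of "U \<inter> U'"]
      by auto
    then show False using U by simp
  qed
  have finW: "finite W" using finU W by blast
  have "card F * (p ^ 2 - p) = (\<Sum>U \<in> F. card (U - W))"
    using cardF cardW finW by (simp add: card_Diff_subset F_def psubset_imp_subset)
  also have "\<dots> = card (\<Union>U \<in> F. U - W)"
    using finF finU interF by (subst card_UN_disjoint) (auto simp: F_def)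
  also have "\<dots> \<le> card (carrier G - W)"
    using fin by (intro card_mono) (auto simp: F_def dest: subgroup.subset)
  also have "\<dots> = p ^ 3 - p"
    using card_Diff_subset[OF finW subgroup.subset[OF W(1)]] ordG cardW by simp
  also have "\<dots> = (p + 1) * (p ^ 2 - p)"
    by (simp add: algebra_simps power2_eq_square power3_eq_cube)
  finally have "card F * (p ^ 2 - p) \<le> (p + 1) * (p ^ 2 - p)" .
  moreover have "0 < p ^ 2 - p" using p2 by (simp add: power2_eq_square)
  ultimately have leF: "card F \<le> p + 1" by (rule mult_right_le_imp_le)
  have "{H. H \<lhd> G} \<subseteq> {{\<one>}, W, carrier G} \<union> F"
  proof
    fix K assume "K \<in> {H. H \<lhd> G}"
    then have K: "K \<lhd> G" "subgroup K G" by (simp_all add: normal_imp_subgroup)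
    show "K \<in> {{\<one>}, W, carrier G} \<union> F"
      using Wsub[OF K(2)] zmin[OF K(1)] K by (auto simp: F_def)
  qed
  then have "card {H. H \<lhd> G} \<le> card ({{\<one>}, W, carrier G} \<union> F)"
    using finF by (intro card_mono) auto
  also have "\<dots> \<le> card {{\<one>}, W, carrier G} + card F" by (rule card_Un_le)
  also have "card {{\<one>}, W, carrier G} \<le> 3" by (simp add: card_insert_if)
  finally have n0: "card {H. H \<lhd> G} \<le> p + 4" using leF by simp
  define e where "e = (\<lambda>(k::nat, b). z [^] k \<otimes> (if b then x else y))"
  have ec: "e kb \<in> carrier G" for kb using zc xy by (auto simp: e_def split: prod.split)
  have ep: "e kb [^] p = \<one>" for kb
  proof -
    obtain k b where kb: "kb = (k, b)" by (cases kb)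
    define v where "v = (if b then x else y)"
    have v: "v \<in> carrier G" "v [^] p = \<one>" using xy xp yp by (auto simp: v_def)
    have "z [^] k \<in> W" by (auto simp: gz)
    then have "(z [^] k \<otimes> v) [^] p = (z [^] k) [^] p \<otimes> v [^] p"
      using v zc by (intro pow_mult_distrib Wcen) auto
    then have "e kb [^] p = (z [^] k) [^] p \<otimes> v [^] p" using kb by (simp add: e_def v_def)
    also have "\<dots> = \<one>" using v zc zpow[of "k * p"] by (simp add: nat_pow_pow)
    finally show ?thesis .
  qed
  have eW: "e kb \<notin> W" for kb
  proof
    assume eW: "e kb \<in> W"
    obtain k b where kb: "kb = (k, b)" by (cases kb)
    define v where "v = (if b then x else y)"
    have v: "v \<in> carrier G" using xy by (auto simp: v_def)
    have zk: "z [^] k \<in> W" "z [^] k \<in> carrier G" using zc by (auto simp: gz)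
    have "inv (z [^] k) \<otimes> e kb \<in> W" using eW zk W(1) by (simp add: subgroup.m_closed subgroup.m_inv_closed)
    then have "v \<in> W" using v zk kb by (simp add: e_def v_def)
    then show False using Wcen[of v x] Wcen[of v y] notcomm xy by (auto simp: v_def split: if_splits)
  qed
  \<comment> \<open>Both \<langle>z\<rangle> and the group generated by \<open>e kb\<close> have
    order \<open>p\<close>. Containing \<open>z\<close> would make them equal, although
    \<open>e kb\<close> is not in \<open>W\<close>. Nonnormality then follows from
    \<open>zmin\<close>.\<close>
  have ze: "z \<notin> generate G {e kb}" for kb
  proof
    assume "z \<in> generate G {e kb}"
    then have "W \<subseteq> generate G {e kb}" using Wsub ec by (simp add: generate_is_subgroup)
    moreover have "ord (e kb) = p"
      using prime_power_one_imp_ord[OF ec _ pq(1) ep] eW subgroup.one_closed[OF W(1)] by metis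
    then have "card (generate G {e kb}) = card W" using generate_pow_card[OF ec] cardW by simp
    moreover have "finite (generate G {e kb})" using finU ec by (simp add: generate_is_subgroup)
    ultimately have "W = generate G {e kb}" by (simp add: card_subset_eq)
    then show False using eW generate.incl[of "e kb" "{e kb}" G] by auto
  qed
  have nonnormal: "\<not> generate G {e kb} \<lhd> G" for kb
  proof
    assume "generate G {e kb} \<lhd> G"
    moreover have "e kb \<noteq> \<one>" using eW subgroup.one_closed[OF W(1)] by metis
    then have "generate G {e kb} \<noteq> {\<one>}" using generate.incl[of "e kb" "{e kb}" G] by auto
    ultimately show False using zmin ze by blast
  qed
  \<comment> \<open>A subgroup with two such generators contains their quotient
    \<open>z [^] (l - k)\<close>, whose exponent is prime to \<open>p\<close> unless it is zero, and
    thus \<open>z\<close>.\<close>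
  have noteq: "k = l" if C: "generate G {e (k, b)} = generate G {e (l, b)}" and "k \<le> l" "l < p" for k l b
  proof (rule ccontr)
    assume "k \<noteq> l"
    define v where "v = (if b then x else y)"
    define C where "C = generate G {e (k, b)}"
    have C: "subgroup C G" "e (k, b) \<in> C" "e (l, b) \<in> C"
      using C ec generate.incl[of "e (k, b)" "{e (k, b)}" G] generate.incl[of "e (l, b)" "{e (l, b)}" G]
      by (auto simp: C_def generate_is_subgroup)
    have v: "v \<in> carrier G" using xy by (auto simp: v_def)
    have "z [^] (l - k) \<otimes> z [^] k = z [^] l" using zc \<open>k \<le> l\<close> by (simp add: nat_pow_mult)
    then have "e (l, b) \<otimes> inv (e (k, b)) = z [^] (l - k)"
      using v zc by (simp add: e_def v_def[symmetric] inv_mult_group m_assoc inv_solve_right')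
    moreover have "e (l, b) \<otimes> inv (e (k, b)) \<in> C"
      using C by (simp add: subgroup.m_closed subgroup.m_inv_closed)
    ultimately have "z [^] (l - k) \<in> C" by simp
    moreover have "z [^] p \<in> C" using zpow[of p] C subgroup.one_closed by simp
    moreover have "coprime (l - k) p"
      using pq(1) \<open>k \<le> l\<close> \<open>k \<noteq> l\<close> \<open>l < p\<close>
      by (metis coprime_commute diff_is_0_eq dvd_imp_le less_imp_diff_less not_less prime_imp_coprime zero_less_iff_neq_zero le_antisym)
    ultimately have "z \<in> C" using coprime_pow_mem[OF C(1) zc(1)] by blast
    then show False using ze by (simp add: C_def)
  qed
  \<comment> \<open>Generators of one cyclic group commute; removing the central factors would make
    \<open>x\<close> and \<open>y\<close> commute.\<close>
  have noteq2: "generate G {e (k, True)} \<noteq> generate G {e (l, False)}" for k l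
  proof
    assume eq: "generate G {e (k, True)} = generate G {e (l, False)}"
    define s where "s = z [^] k"
    define t where "t = z [^] l"
    have st: "s \<in> W" "t \<in> W" "s \<in> carrier G" "t \<in> carrier G" using zc by (auto simp: s_def t_def gz)
    have "e (l, False) \<in> generate G {e (k, True)}" unfolding eq by (simp add: generate.incl)
    then have "e (l, False) \<otimes> e (k, True) = e (k, True) \<otimes> e (l, False)"
      using generate_singleton_commute ec by blast
    then have 1: "t \<otimes> y \<otimes> (s \<otimes> x) = s \<otimes> x \<otimes> (t \<otimes> y)" by (simp add: e_def s_def t_def)
    have "t \<otimes> y \<otimes> (s \<otimes> x) = t \<otimes> (y \<otimes> s) \<otimes> x" using st xy by (simp add: m_assoc)
    also have "\<dots> = t \<otimes> s \<otimes> (y \<otimes> x)" unfolding Wcen[OF st(1) xy(2), symmetric] using st xy by (simp add: m_assoc)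
    finally have 2: "t \<otimes> y \<otimes> (s \<otimes> x) = t \<otimes> s \<otimes> (y \<otimes> x)" .
    have "s \<otimes> x \<otimes> (t \<otimes> y) = s \<otimes> (x \<otimes> t) \<otimes> y" using st xy by (simp add: m_assoc)
    also have "\<dots> = s \<otimes> t \<otimes> (x \<otimes> y)" unfolding Wcen[OF st(2) xy(1), symmetric] using st xy by (simp add: m_assoc)
    also have "\<dots> = t \<otimes> s \<otimes> (x \<otimes> y)" unfolding Wcen[OF st(1,4)] ..
    finally have "t \<otimes> s \<otimes> (y \<otimes> x) = t \<otimes> s \<otimes> (x \<otimes> y)" using 1 2 by simp
    then have "y \<otimes> x = x \<otimes> y" using st xy by simp
    then show False using notcomm by simp
  qed
  have "inj_on (\<lambda>kb. generate G {e kb}) ({..<p} \<times> UNIV)"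
  proof (rule inj_onI)
    fix u v assume uv: "u \<in> {..<p} \<times> UNIV" "v \<in> {..<p} \<times> UNIV"
      "generate G {e u} = generate G {e v}"
    obtain k b l c where kblc: "u = (k, b)" "v = (l, c)" by (cases u, cases v)
    have kl: "k \<in> {..<p}" "l \<in> {..<p}" and eq: "generate G {e (k, b)} = generate G {e (l, c)}"
      using uv kblc by auto
    have bc: "b = c"
    proof (rule ccontr)
      assume "b \<noteq> c"
      then consider "b = True" "c = False" | "b = False" "c = True" by (cases b; cases c) simp_all
      then show False
      proof cases
        case 1
        then show ?thesis using eq noteq2[of k l] by simp
      next
        case 2
        then show ?thesis using eq[symmetric] noteq2[of l k] by simp
      qed
    qed
    moreover have "k = l"
    proof (cases "k \<le> l")
      case True
      show ?thesis using noteq[OF eq[unfolded bc] True] kl by simp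
    next
      case False
      then show ?thesis using noteq[OF eq[unfolded bc, symmetric]] kl by simp
    qed
    ultimately show "u = v" using kblc by simp
  qed
  moreover have "(\<lambda>kb. generate G {e kb}) ` ({..<p} \<times> UNIV) \<subseteq> {H. subgroup H G \<and> \<not> H \<lhd> G}"
    using nonnormal ec by (auto simp: generate_is_subgroup)
  moreover have "finite {H. subgroup H G \<and> \<not> H \<lhd> G}" using finite_subgroups[OF fin] by simp
  ultimately have "card ({..<p} \<times> (UNIV :: bool set)) \<le> card {H. subgroup H G \<and> \<not> H \<lhd> G}"
    by (rule card_inj_on_le)
  then have "2 * p \<le> card {H. subgroup H G \<and> \<not> H \<lhd> G}" by (simp add: card_cartesian_product)
  \<comment> \<open>Three times 2p is at least 2(p + 4) precisely when p \<ge> 2.\<close>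
  then show ?thesis using n0 p2 by (simp add: mostly_normal_def)
qed

end

section \<open>Permutability of cyclic subgroups\<close>

context group
begin

text \<open>Inside \<langle>x\<rangle>\<open>Q\<close> the normalizer condition supplies an element
  outside \<langle>x^p\<rangle>\<open>Q\<close> that normalises it. Stripping off its factor from
  \<open>Q\<close> leaves a power \<open>x [^] i\<close> in the normaliser. The latter also contains
  \<open>x [^] p\<close>, and coprime exponents give \<open>x\<close>.\<close>

lemma conjugate_power_set_mult:
  fixes p :: nat
  assumes fin: "finite (carrier G)" and nc: "normalizer_condition G"
    and x: "x \<in> carrier G" and p: "Factorial_Ring.prime p" and Q: "subgroup Q G"
    and N: "subgroup (generate G {x [^] p} <#> Q) G" and S: "subgroup (generate G {x} <#> Q) G"
  shows "conjugate G x (generate G {x [^] p} <#> Q) = generate G {x [^] p} <#> Q"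
proof (cases "x \<in> generate G {x [^] p} <#> Q")
  case True
  then show ?thesis using conjugate_self N by blast
next
  case False
  define M where "M = generate G {x [^] p} <#> Q"
  define U where "U = {g \<in> carrier G. conjugate G g M = M}"
  have M: "subgroup M G" "M \<subseteq> carrier G" "finite M"
    using N fin by (auto simp: M_def subgroup.subset intro: finite_subset[OF subgroup.subset])
  have U: "subgroup U G" unfolding U_def using M(2) by (rule subgroup_normalizer)
  have MU: "M \<subseteq> U" using conjugate_self[OF M(1)] M(2) by (auto simp: U_def)
  have sx: "subgroup (generate G {x}) G" "x \<in> generate G {x}"
    using x by (auto simp: generate_is_subgroup generate.incl)
  have sxp: "subgroup (generate G {x [^] p}) G" "x [^] p \<in> generate G {x [^] p}"
    using x by (auto simp: generate_is_subgroup generate.incl)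
  have gx: "generate G {x} = {x [^] i | i. i \<in> (UNIV :: nat set)}"
    and gxp: "generate G {x [^] p} = {(x [^] p) [^] i | i. i \<in> (UNIV :: nat set)}"
    using generate_pow_on_finite_carrier[OF fin] x by auto
  have "x [^] p \<in> generate G {x}" unfolding gx by blast
  then have "generate G {x [^] p} \<subseteq> generate G {x}"
    using sx(1) by (intro generate_subgroup_incl) auto
  then have sub: "M \<subseteq> generate G {x} <#> Q" unfolding M_def by (intro mono_set_mult) auto
  have "x \<in> generate G {x} <#> Q"
    using subset_set_mult_left[OF Q subgroup.subset[OF sx(1)]] sx(2) by blast
  then have "M \<subset> generate G {x} <#> Q" using sub False by (auto simp: M_def)
  then obtain g where g: "g \<in> generate G {x} <#> Q" "g \<notin> M" "\<forall>a \<in> M. g \<otimes> a \<otimes> inv g \<in> M"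
    using nc M(1) S unfolding normalizer_condition_def by blast
  have gc: "g \<in> carrier G" using g(1) S by (auto dest: subgroup.subset)
  have "conjugate G g M = M"
    by (rule card_subset_eq[OF M(3) _ card_conjugate[OF M(2) gc]])
      (use g(3) in \<open>auto simp: conjugate_def\<close>)
  then have gU: "g \<in> U" using gc by (simp add: U_def)
  obtain i c where ic: "c \<in> Q" "g = x [^] (i::nat) \<otimes> c"
    using g(1) unfolding mem_set_mult_iff gx by blast
  have cc: "c \<in> carrier G" using ic Q by (auto dest: subgroup.subset)
  have "c \<in> U"
    using ic MU subset_set_mult_right[OF sxp(1) subgroup.subset[OF Q]] by (auto simp: M_def)
  moreover have "x [^] i = g \<otimes> inv c" using ic(2) cc x by (simp add: m_assoc)
  ultimately have "x [^] i \<in> U" using gU U by (simp add: subgroup.m_closed subgroup.m_inv_closed)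
  moreover have "x [^] p \<in> U"
    using sxp(2) MU subset_set_mult_left[OF Q subgroup.subset[OF sxp(1)]] by (auto simp: M_def)
  \<comment> \<open>Otherwise \<open>x [^] i\<close> would be a power of \<open>x [^] p\<close> and
    \<open>g\<close> would lie in \<open>M\<close>.\<close>
  moreover have "\<not> p dvd i"
  proof
    assume "p dvd i"
    then obtain k where "i = p * k" by auto
    then have "x [^] i = (x [^] p) [^] k" using x by (simp add: nat_pow_pow)
    then have "x [^] i \<in> generate G {x [^] p}" unfolding gxp by blast
    then have "g \<in> M" unfolding M_def ic(2) using ic(1) by (rule set_multI)
    then show False using g by simp
  qed
  then have "coprime i p" using prime_imp_coprime[OF p] coprime_commute by blast
  ultimately have "x \<in> U" using coprime_pow_mem[OF U x] by blast
  then show ?thesis by (simp add: U_def M_def)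
qed

lemma set_mult_commute_if_subset:
  assumes A: "subgroup A G" and B: "subgroup B G" and BA: "B <#> A \<subseteq> A <#> B"
  shows "A <#> B = B <#> A"
proof
  show "A <#> B \<subseteq> B <#> A"
  proof
    fix x assume "x \<in> A <#> B"
    then obtain a b where ab: "a \<in> A" "b \<in> B" "x = a \<otimes> b" by (auto simp: mem_set_mult_iff)
    have "inv b \<otimes> inv a \<in> A <#> B"
      using BA set_multI[of "inv b" B "inv a" A] ab A B by (auto simp: subgroup.m_inv_closed)
    then obtain a' b' where ab': "a' \<in> A" "b' \<in> B" "inv b \<otimes> inv a = a' \<otimes> b'"
      by (auto simp: mem_set_mult_iff)
    have c: "a \<in> carrier G" "b \<in> carrier G" "a' \<in> carrier G" "b' \<in> carrier G"
      using ab ab' A B by (auto dest: subgroup.subset)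
    have "x = inv (inv b \<otimes> inv a)" using c ab by (simp add: inv_mult_group)
    also have "\<dots> = inv b' \<otimes> inv a'" unfolding ab'(3) using c by (simp add: inv_mult_group)
    finally show "x \<in> B <#> A"
      using set_multI[of "inv b'" B "inv a'" A] ab' A B by (simp add: subgroup.m_inv_closed)
  qed
qed (rule BA)

text \<open>The group \<open>R\<close> = \<open>N\<close>\<langle>x\<rangle> is normalised by
  \<open>y\<close>, since \<open>y\<close> conjugates \<open>x\<close> to the inverse of the
  commutator times \<open>x\<close>. As \<open>R\<close> lies in
  \<langle>x\<rangle>\<open>Q\<close>, conjugating \<open>u\<close> in \<langle>x\<rangle> by
  \<open>v\<close> in \<langle>y\<rangle> gives \<open>u' \<otimes> d\<close> with \<open>d\<close>
  in \<open>Q\<close>, so \<open>v \<otimes> u\<close> equals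
  \<open>u' \<otimes> (d \<otimes> v)\<close>, where \<open>d \<otimes> v\<close> is in
  \<langle>y\<rangle>.\<close>

lemma cyclic_permutable_if_commutator_mem:
  assumes fin: "finite (carrier G)" and x: "x \<in> carrier G" and y: "y \<in> carrier G"
    and N: "subgroup N G" "conjugate G x N = N" "conjugate G y N = N"
    and S: "subgroup (generate G {x} <#> Q) G" "N \<subseteq> generate G {x} <#> Q"
    and Q: "subgroup Q G" "Q \<subseteq> generate G {y}"
    and comm: "x \<otimes> y \<otimes> inv x \<otimes> inv y \<in> N"
  shows "generate G {x} <#> generate G {y} = generate G {y} <#> generate G {x}"
proof (rule set_mult_commute_if_subset)
  show sx: "subgroup (generate G {x}) G" and sy: "subgroup (generate G {y}) G"
    using x y by (simp_all add: generate_is_subgroup)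
  have Nc: "N \<subseteq> carrier G" using N(1) by (rule subgroup.subset)
  have "generate G {x} \<subseteq> {g \<in> carrier G. conjugate G g N = N}"
    using x N by (intro generate_subgroup_incl[OF _ subgroup_normalizer[OF Nc]]) auto
  then have "\<And>a b. a \<in> N \<Longrightarrow> b \<in> generate G {x} \<Longrightarrow> b \<otimes> a \<otimes> inv b \<in> N"
    by (auto simp: conjugate_def)
  define R where "R = N <#> generate G {x}"
  have R: "subgroup R G" unfolding R_def by (rule subgroup_set_mult_normalizing[OF N(1) sx]) fact
  have Rc: "R \<subseteq> carrier G" using R by (rule subgroup.subset)
  have NR: "N \<subseteq> R" unfolding R_def using subset_set_mult_left[OF sx Nc] .
  have xR: "generate G {x} \<subseteq> R"
    unfolding R_def using subset_set_mult_right[OF N(1) subgroup.subset[OF sx]] .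
  have xx: "x \<in> generate G {x}" by (simp add: generate.incl)
  have sxc: "generate G {x} \<subseteq> generate G {x} <#> Q"
    using subset_set_mult_left[OF Q(1) subgroup.subset[OF sx]] .
  have RS: "R \<subseteq> generate G {x} <#> Q"
  proof
    fix r assume "r \<in> R"
    then obtain n u where "n \<in> N" "u \<in> generate G {x}" "r = n \<otimes> u"
      by (auto simp: R_def mem_set_mult_iff)
    then show "r \<in> generate G {x} <#> Q" using S sxc by (auto intro: subgroup.m_closed)
  qed
  define R' where "R' = conjugate G (inv y) R"
  have R': "subgroup R' G" unfolding R'_def using R y by (simp add: conjugate_subgroup)
  have "N = conjugate G (inv y) (conjugate G y N)" using conjugate_inv_conjugate[OF Nc y] by simp
  then have "N = conjugate G (inv y) N" using N(3) by simp
  then have NR': "N \<subseteq> R'" using NR by (auto simp: R'_def conjugate_def)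
  have "inv (x \<otimes> y \<otimes> inv x \<otimes> inv y) \<otimes> x \<in> R"
    using comm N(1) xx unfolding R_def by (intro set_multI subgroup.m_inv_closed)
  then have "y \<otimes> x \<otimes> inv y \<in> R" using x y by (simp add: inv_mult_group m_assoc)
  moreover have "x = inv y \<otimes> (y \<otimes> x \<otimes> inv y) \<otimes> inv (inv y)" using x y by (simp add: m_assoc)
  ultimately have "x \<in> R'" unfolding R'_def conjugate_def by blast
  then have xR': "generate G {x} \<subseteq> R'" using R' by (simp add: generate_subgroup_incl)
  \<comment> \<open>One inclusion between a subgroup and its conjugate suffices, as they have the
    same finite size.\<close>
  have RR': "R \<subseteq> R'"
  proof
    fix r assume "r \<in> R"
    then obtain n u where "n \<in> N" "u \<in> generate G {x}" "r = n \<otimes> u"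
      by (auto simp: R_def mem_set_mult_iff)
    then show "r \<in> R'" using NR' xR' subgroup.m_closed[OF R'] by blast
  qed
  have "card R' = card R" unfolding R'_def using Rc y by (simp add: card_conjugate)
  moreover have "finite R'" using subgroup.subset[OF R'] fin by (rule finite_subset)
  ultimately have "R = R'" using RR' by (simp add: card_subset_eq)
  then have "inv y \<in> {g \<in> carrier G. conjugate G g R = R}" using y by (simp add: R'_def)
  then have "inv (inv y) \<in> {g \<in> carrier G. conjugate G g R = R}"
    by (rule subgroup.m_inv_closed[OF subgroup_normalizer[OF Rc]])
  then have "generate G {y} \<subseteq> {g \<in> carrier G. conjugate G g R = R}"
    using y by (intro generate_subgroup_incl[OF _ subgroup_normalizer[OF Rc]]) auto
  then have yR: "v \<otimes> u \<otimes> inv v \<in> R" if "v \<in> generate G {y}" "u \<in> R" for u v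
    using that by (auto simp: conjugate_def)
  show "generate G {y} <#> generate G {x} \<subseteq> generate G {x} <#> generate G {y}"
  proof
    fix w assume "w \<in> generate G {y} <#> generate G {x}"
    then obtain v u where vu: "v \<in> generate G {y}" "u \<in> generate G {x}" "w = v \<otimes> u"
      by (auto simp: mem_set_mult_iff)
    have c: "v \<in> carrier G" "u \<in> carrier G" using vu sx sy by (auto dest: subgroup.subset)
    have "v \<otimes> u \<otimes> inv v \<in> generate G {x} <#> Q" using yR[OF vu(1)] vu(2) xR RS by blast
    then obtain u' d where ud: "u' \<in> generate G {x}" "d \<in> Q" "v \<otimes> u \<otimes> inv v = u' \<otimes> d"
      by (auto simp: mem_set_mult_iff)
    have c': "u' \<in> carrier G" "d \<in> carrier G"
      using ud sx Q(1) by (auto dest: subgroup.subset)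
    have "w = v \<otimes> u \<otimes> inv v \<otimes> v" using vu(3) c by (simp add: m_assoc)
    also have "\<dots> = u' \<otimes> (d \<otimes> v)" unfolding ud(3) using c c' by (simp add: m_assoc)
    finally show "w \<in> generate G {x} <#> generate G {y}"
      using set_multI[of u' "generate G {x}" "d \<otimes> v" "generate G {y}"] ud vu Q(2) sy
      by (auto simp: subgroup.m_closed)
  qed
qed

text \<open>\<open>K\<close> is maximal among the normal subgroups above \<open>N\<close> that miss
  the commutator \<open>z\<close>. A nontrivial normal subgroup of the quotient has a preimage
  larger than \<open>K\<close>, which must contain \<open>z\<close>; this is the hypothesis
  \<open>min\<close> of the two-generator count.\<close>

lemma not_mostly_normal_section:
  fixes p q :: nat
  assumes fin: "finite (carrier G)" and nc: "normalizer_condition G"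
    and gen: "generate G {x, y} = carrier G" and x: "x \<in> carrier G" and y: "y \<in> carrier G"
    and pq: "Factorial_Ring.prime p" "Factorial_Ring.prime q"
    and N: "N \<lhd> G" and xp: "x [^] p \<in> N" and yq: "y [^] q \<in> N"
    and comm: "x \<otimes> y \<otimes> inv x \<otimes> inv y \<notin> N"
  obtains K where "K \<lhd> G" "\<not> mostly_normal (G Mod K)"
proof -
  define z where "z = x \<otimes> y \<otimes> inv x \<otimes> inv y"
  have zc: "z \<in> carrier G" using x y by (simp add: z_def)
  have "finite {K. K \<lhd> G \<and> N \<subseteq> K \<and> z \<notin> K}" using finite_normals[OF fin] by simp
  moreover have "N \<in> {K. K \<lhd> G \<and> N \<subseteq> K \<and> z \<notin> K}" using N comm by (simp add: z_def)
  ultimately obtain K where K0: "K \<in> {K. K \<lhd> G \<and> N \<subseteq> K \<and> z \<notin> K}"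
    and Kmax: "\<And>L. L \<in> {K. K \<lhd> G \<and> N \<subseteq> K \<and> z \<notin> K} \<Longrightarrow> K \<subseteq> L \<Longrightarrow> L = K"
    by (metis (no_types, lifting) empty_iff finite_has_maximal)
  have K: "K \<lhd> G" "N \<subseteq> K" "z \<notin> K" using K0 by auto
  interpret K: normal K G using K(1) .
  interpret h: group_hom G "G Mod K" "\<lambda>a. K #> a" by (rule K.group_hom_Mod)
  have hz: "(K #> x) \<otimes>\<^bsub>G Mod K\<^esub> (K #> y) \<otimes>\<^bsub>G Mod K\<^esub> inv\<^bsub>G Mod K\<^esub> (K #> x)
      \<otimes>\<^bsub>G Mod K\<^esub> inv\<^bsub>G Mod K\<^esub> (K #> y) = K #> z"
    unfolding z_def using x y h.hom_mult h.hom_inv by (metis inv_closed m_closed)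
  have z1: "K #> z \<noteq> \<one>\<^bsub>G Mod K\<^esub>" using K(3) K.rcos_eq_self_iff[OF zc] by simp
  have finS: "finite (carrier (G Mod K))" using K.finite_Mod[OF fin] .
  have "carrier (G Mod K) \<noteq> {\<one>\<^bsub>G Mod K\<^esub>}" using z1 h.hom_closed[OF zc] by blast
  then obtain c where c: "c \<in> carrier (G Mod K)" "c \<noteq> \<one>\<^bsub>G Mod K\<^esub>"
    "\<And>v. v \<in> carrier (G Mod K) \<Longrightarrow> c \<otimes>\<^bsub>G Mod K\<^esub> v = v \<otimes>\<^bsub>G Mod K\<^esub> c"
    using h.H.nontrivial_central_element[OF finS normalizer_condition_Mod[OF nc K(1)]] by blast
  have "\<not> mostly_normal (G Mod K)"
  proof (rule h.H.not_mostly_normal_two_generators[OF finS h.hom_closed[OF x] h.hom_closed[OF y] _ pq _ _ _ _ c])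
    show "generate (G Mod K) {K #> x, K #> y} = carrier (G Mod K)"
      using h.generate_img[of "{x, y}"] x y gen K.Mod_surj by simp
    show "(K #> x) [^]\<^bsub>G Mod K\<^esub> p = \<one>\<^bsub>G Mod K\<^esub>"
      using h.hom_nat_pow[OF x, of p] K.rcos_eq_self_iff[of "x [^] p"] x xp K(2) by auto
    show "(K #> y) [^]\<^bsub>G Mod K\<^esub> q = \<one>\<^bsub>G Mod K\<^esub>"
      using h.hom_nat_pow[OF y, of q] K.rcos_eq_self_iff[of "y [^] q"] y yq K(2) by auto
    show "(K #> x) \<otimes>\<^bsub>G Mod K\<^esub> (K #> y) \<otimes>\<^bsub>G Mod K\<^esub> inv\<^bsub>G Mod K\<^esub> (K #> x)
      \<otimes>\<^bsub>G Mod K\<^esub> inv\<^bsub>G Mod K\<^esub> (K #> y) \<noteq> \<one>\<^bsub>G Mod K\<^esub>" unfolding hz by (rule z1)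
    fix L assume L: "L \<lhd> G Mod K" "L \<noteq> {\<one>\<^bsub>G Mod K\<^esub>}"
    define L' where "L' = {g \<in> carrier G. K #> g \<in> L}"
    have L': "L' \<lhd> G" unfolding L'_def using h.normal_vimage[OF L(1)] .
    have L1: "\<one>\<^bsub>G Mod K\<^esub> \<in> L" using L(1) by (simp add: normal_imp_subgroup subgroup.one_closed del: one_FactGroup)
    have KL: "K \<subseteq> L'"
    proof
      fix k assume "k \<in> K"
      then show "k \<in> L'" using K.subset K.rcos_eq_self_iff[of k] L1 by (auto simp: L'_def)
    qed
    have "z \<in> L'"
    proof (rule ccontr)
      assume "z \<notin> L'"
      then have "L' = K" using L' KL K(2) by (intro Kmax) auto
      have "L \<subseteq> {\<one>\<^bsub>G Mod K\<^esub>}"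
      proof
        fix l assume l: "l \<in> L"
        then have "l \<in> carrier (G Mod K)" using L(1) by (meson normal_imp_subgroup subgroup.mem_carrier)
        then obtain g where g: "g \<in> carrier G" "l = K #> g" unfolding K.Mod_surj[symmetric] by blast
        then have "g \<in> K" using l \<open>L' = K\<close> by (auto simp: L'_def)
        then show "l \<in> {\<one>\<^bsub>G Mod K\<^esub>}" using g K.rcos_eq_self_iff[of g] by simp
      qed
      then show False using L(2) L1 by auto
    qed
    then show "(K #> x) \<otimes>\<^bsub>G Mod K\<^esub> (K #> y) \<otimes>\<^bsub>G Mod K\<^esub> inv\<^bsub>G Mod K\<^esub> (K #> x)
      \<otimes>\<^bsub>G Mod K\<^esub> inv\<^bsub>G Mod K\<^esub> (K #> y) \<in> L" unfolding hz by (simp add: L'_def)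
  qed
  then show ?thesis using that K(1) by blast
qed

text \<open>Replacing a generator by a power of prime exponent dividing its order lowers the sum of
  the orders. Three instances of the induction hypothesis are used: (x^p, y^q) makes
  \<open>N\<close> a subgroup, while (x, y^q) and (x^p, y) provide the overgroups in which
  \<open>x\<close> and \<open>y\<close> are shown to normalise \<open>N\<close>.\<close>

lemma cyclic_permutable:
  assumes fin: "finite (carrier G)"
    and mn: "\<And>H R. subgroup H G \<Longrightarrow> R \<lhd> G\<lparr>carrier := H\<rparr> \<Longrightarrow> mostly_normal (G\<lparr>carrier := H\<rparr> Mod R)"
  shows "x \<in> carrier G \<Longrightarrow> y \<in> carrier G \<Longrightarrow>
    generate G {x} <#> generate G {y} = generate G {y} <#> generate G {x}"
proof (induction "ord x + ord y" arbitrary: x y rule: less_induct)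
  case less
  have x: "x \<in> carrier G" and y: "y \<in> carrier G" using less.prems by auto
  have nc: "normalizer_condition G" using normalizer_condition_if_mostly_normal[OF fin mn] .
  have sg: "subgroup (generate G {a}) G" if "a \<in> carrier G" for a using that by (simp add: generate_is_subgroup)
  have one: "{\<one>} <#> A = A" "A <#> {\<one>} = A" if "A \<subseteq> carrier G" for A
    using that by (auto simp: set_mult_def subset_iff)
  have prime: "\<exists>p :: nat. Factorial_Ring.prime p \<and> ord (a [^] p) < ord a" if a: "a \<in> carrier G" "a \<noteq> \<one>" for a
  proof -
    have o: "ord a \<noteq> 1" "0 < ord a" using a ord_eq_1[OF a(1)] ord_ge_1[OF fin a(1)] by auto
    obtain p where p: "Factorial_Ring.prime p" "p dvd ord a" using prime_factor_nat[OF o(1)] by blast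
    have "ord (a [^] p) = ord a div p" using ord_pow[OF a(1) p(2)] p(1) by (simp add: prime_gt_0_nat)
    also have "\<dots> < ord a" using o(2) prime_gt_1_nat[OF p(1)] by simp
    finally show ?thesis using p by blast
  qed
  show ?case
  proof (cases "x = \<one> \<or> y = \<one>")
    case True
    then show ?thesis
      using one subgroup.subset[OF sg[OF x]] subgroup.subset[OF sg[OF y]] generate_one by auto
  next
    case False
    then obtain p q :: nat where p: "Factorial_Ring.prime p" "ord (x [^] p) < ord x"
      and q: "Factorial_Ring.prime q" "ord (y [^] q) < ord y" using prime x y by meson
    define P where "P = generate G {x [^] p}"
    define Q where "Q = generate G {y [^] q}"
    have P: "subgroup P G" and Q: "subgroup Q G" using sg x y by (simp_all add: P_def Q_def)
    have PQ: "P <#> Q = Q <#> P" unfolding P_def Q_def using less.hyps[of "x [^] p" "y [^] q"] p q x y by simp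
    have xQ: "generate G {x} <#> Q = Q <#> generate G {x}"
      unfolding Q_def using less.hyps[of x "y [^] q"] q x y by simp
    have yP: "generate G {y} <#> P = P <#> generate G {y}"
      unfolding P_def using less.hyps[of "x [^] p" y] p x y by simp
    define N where "N = P <#> Q"
    have N: "subgroup N G" unfolding N_def using P Q PQ by (rule subgroup_set_mult_commute)
    have S: "subgroup (generate G {x} <#> Q) G" using subgroup_set_mult_commute[OF sg[OF x] Q xQ] .
    have T: "subgroup (generate G {y} <#> P) G" using subgroup_set_mult_commute[OF sg[OF y] P yP] .
    have xN: "conjugate G x N = N"
      unfolding N_def P_def
      by (rule conjugate_power_set_mult[OF fin nc x p(1) Q _ S]) (use N in \<open>simp add: N_def P_def\<close>)
    \<comment> \<open>The roles are exchanged here, so \<open>N\<close> is first rewritten as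
      \<open>Q <#> P\<close>.\<close>
    have yN: "conjugate G y N = N"
      unfolding N_def PQ unfolding Q_def
      by (rule conjugate_power_set_mult[OF fin nc y q(1) P _ T])
        (use N in \<open>simp add: N_def PQ flip: Q_def\<close>)
    have Nc: "N \<subseteq> carrier G" using N by (rule subgroup.subset)
    have xpP: "x [^] p \<in> P" "y [^] q \<in> Q" by (simp_all add: P_def Q_def generate.incl)
    have PN: "P \<subseteq> N" "Q \<subseteq> N" unfolding N_def
      using subset_set_mult_left[OF Q subgroup.subset[OF P]] subset_set_mult_right[OF P subgroup.subset[OF Q]] by auto
    have pow_mem: "a [^] (n::nat) \<in> H" if "subgroup H G" "a \<in> H" for a n H
      using subgroup_int_pow_closed[OF that, of "int n"] by (simp add: int_pow_int)
    have Px: "P \<subseteq> generate G {x}" unfolding P_def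
      using pow_mem[OF sg[OF x], of x p] sg[OF x] by (simp add: generate_subgroup_incl generate.incl)
    have Qy: "Q \<subseteq> generate G {y}" unfolding Q_def
      using pow_mem[OF sg[OF y], of y q] sg[OF y] by (simp add: generate_subgroup_incl generate.incl)
    show ?thesis
    proof (cases "x \<otimes> y \<otimes> inv x \<otimes> inv y \<in> N")
      case True
      show ?thesis
        by (rule cyclic_permutable_if_commutator_mem[OF fin x y N xN yN S _ Q Qy True])
          (simp add: N_def mono_set_mult Px)
    next
      case False
      define H where "H = generate G {x, y}"
      have H: "subgroup H G" "x \<in> H" "y \<in> H"
        using x y by (auto simp: H_def generate_is_subgroup generate.incl)
      interpret H: group "G\<lparr>carrier := H\<rparr>" using H(1) by (rule subgroup_imp_group)
      have "P \<subseteq> H" "Q \<subseteq> H"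
        unfolding P_def Q_def using pow_mem[OF H(1)] H by (simp_all add: generate_subgroup_incl)
      then have NH: "N \<subseteq> H"
        unfolding N_def using subgroup.m_closed[OF H(1)] by (auto simp: mem_set_mult_iff subset_iff)
      have HN: "H \<subseteq> {g \<in> carrier G. conjugate G g N = N}"
        unfolding H_def using x y xN yN
        by (intro generate_subgroup_incl[OF _ subgroup_normalizer[OF Nc]]) auto
      have NHn: "N \<lhd> G\<lparr>carrier := H\<rparr>"
        unfolding H.normal_inv_iff
        using subgroup_incl[OF N H(1) NH] HN m_inv_consistent[OF H(1)] by (auto simp: conjugate_def)
      have finH: "finite (carrier (G\<lparr>carrier := H\<rparr>))"
        using fin subgroup.subset[OF H(1)] by (auto intro: finite_subset)
      have gen: "generate (G\<lparr>carrier := H\<rparr>) {x, y} = carrier (G\<lparr>carrier := H\<rparr>)"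
        using generate_consistent[of "{x, y}" H] H by (simp add: H_def)
      obtain K where "K \<lhd> G\<lparr>carrier := H\<rparr>" "\<not> mostly_normal (G\<lparr>carrier := H\<rparr> Mod K)"
        by (rule H.not_mostly_normal_section[OF finH normalizer_condition_subgroup[OF nc H(1)] gen
              _ _ p(1) q(1) NHn])
          (use H False xpP PN m_inv_consistent[OF H(1)] in
            \<open>auto simp flip: nat_pow_consistent\<close>)
      then show ?thesis using mn H(1) by blast
    qed
  qed
qed

end

section \<open>Sections and the dihedral group of order 8\<close>

lemma (in group) subset_Pow_subgroup_conj_classes: "subgroup_conj_classes G \<subseteq> Pow (Pow (carrier G))"
proof -
  have "conjugate G g H \<subseteq> carrier G" if "g \<in> carrier G" "subgroup H G" for g H
    using conjugate_subgroup[OF that(2,1)] by (rule subgroup.subset)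
  then show ?thesis by (auto simp: subgroup_conj_classes_eq)
qed

lemma (in group) iso_subgroup_conj_classes_subset:
  assumes "group H" "h \<in> iso G H"
  shows "image (image h) ` subgroup_conj_classes G \<subseteq> subgroup_conj_classes H"
proof -
  interpret h: group_hom G H h
    using assms by (simp add: group_hom_def group_hom_axioms_def is_group iso_def)
  have surj: "h ` carrier G = carrier H" using assms(2) by (simp add: iso_def bij_betw_def)
  have conj: "h ` conjugate G g U = conjugate H (h g) (h ` U)" if "g \<in> carrier G" "subgroup U G" for g U
    unfolding conjugate_def image_image
    by (rule image_cong) (use that in \<open>auto simp: subgroup.mem_carrier\<close>)
  show ?thesis
  proof
    fix C assume "C \<in> image (image h) ` subgroup_conj_classes G"
    then obtain U where U: "subgroup U G" "C = image h ` {conjugate G g U | g. g \<in> carrier G}"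
      by (auto simp: subgroup_conj_classes_eq)
    have "C = (\<lambda>g. conjugate H (h g) (h ` U)) ` carrier G"
      unfolding U(2) Setcompr_eq_image image_image by (rule image_cong) (use conj U in auto)
    also have "\<dots> = {conjugate H g (h ` U) | g. g \<in> carrier H}"
      unfolding Setcompr_eq_image surj[symmetric] image_image ..
    finally show "C \<in> subgroup_conj_classes H"
      using h.subgroup_img_is_subgroup[OF U(1)] by (auto simp: h.H.subgroup_conj_classes_eq)
  qed
qed

text \<open>The section of \<open>D8\<close> by the trivial subgroup consists of cosets and lives on
  another type, so its value must be transported along an isomorphism.\<close>

lemma (in group) d_prime_iso:
  assumes "group H" "h \<in> iso G H" and fin: "finite (carrier G)"
  shows "d_prime G = d_prime H"
proof -
  \<comment> \<open>Stated for arbitrary types because it is applied to \<open>h\<close> and to its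
    inverse; the two inequalities give equality.\<close>
  have le: "card (subgroup_conj_classes G) \<le> card (subgroup_conj_classes H) \<and>
      card {U. subgroup U G} \<le> card {U. subgroup U H}"
    if "group G" "group H" "h \<in> iso G H" "finite (carrier H)"
    for G :: "('x, 'y) monoid_scheme" and H :: "('z, 'w) monoid_scheme" and h
  proof -
    interpret G: group G by fact
    interpret H: group H by fact
    interpret h: group_hom G H h
      using that by (simp add: group_hom_def group_hom_axioms_def iso_def)
    have inj: "inj_on h (carrier G)" using that(3) by (simp add: iso_def bij_betw_def)
    have "inj_on (image (image h)) (subgroup_conj_classes G)"
      by (rule inj_on_subset[OF inj_on_image_Pow[OF inj_on_image_Pow[OF inj]]
            G.subset_Pow_subgroup_conj_classes])
    moreover have "finite (subgroup_conj_classes H)"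
      by (rule finite_subset[OF H.subset_Pow_subgroup_conj_classes]) (use that(4) in simp)
    ultimately have "card (subgroup_conj_classes G) \<le> card (subgroup_conj_classes H)"
      using G.iso_subgroup_conj_classes_subset[OF that(2,3)] by (intro card_inj_on_le)
    moreover have "inj_on (image h) {U. subgroup U G}"
      by (rule inj_on_subset[OF inj_on_image_Pow[OF inj]]) (auto dest: subgroup.subset)
    then have "card {U. subgroup U G} \<le> card {U. subgroup U H}"
      using H.finite_subgroups[OF that(4)] h.subgroup_img_is_subgroup
      by (intro card_inj_on_le[of "image h"]) auto
    ultimately show ?thesis ..
  qed
  have "inv_into (carrier G) h \<in> iso H G" using assms(2) by (rule iso_set_sym)
  moreover have "carrier H = h ` carrier G" using assms(2) by (simp add: iso_def bij_betw_def)
  then have "finite (carrier H)" using fin by simp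
  ultimately show ?thesis
    using le[OF is_group assms(1,2)] le[OF assms(1) is_group] fin
    by (auto simp: d_prime_def subgroup_lattice_def)
qed

lemma (in group) d_prime_eq_1_if_all_normal:
  assumes fin: "finite (carrier G)" and normal: "\<And>H. subgroup H G \<Longrightarrow> H \<lhd> G"
  shows "d_prime G = 1"
proof -
  have "{conjugate G g H | g. g \<in> carrier G} = {H}" if "subgroup H G" for H
    using normal_iff_conjugate_eq[OF that fin] normal[OF that] by auto
  then have "subgroup_conj_classes G = (\<lambda>H. {H}) ` {H. subgroup H G}"
    by (auto simp: subgroup_conj_classes_eq)
  then have "card (subgroup_conj_classes G) = card {H. subgroup H G}"
    by (simp add: card_image)
  moreover have "card {H. subgroup H G} > 0"
    using finite_subgroups[OF fin] triv_subgroup by (auto simp: card_gt_0_iff)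
  ultimately show ?thesis by (simp add: d_prime_def subgroup_lattice_def)
qed

text \<open>If \<open>x\<close> and \<open>y\<close> do not commute, then \<open>1, x, y, x y, y x\<close> are five different elements.\<close>

lemma (in group) comm_group_if_card_le_4:
  assumes fin: "finite (carrier G)" and card: "card (carrier G) \<le> 4"
  shows "comm_group G"
proof (rule group_comm_groupI, rule ccontr)
  fix x y assume xy: "x \<in> carrier G" "y \<in> carrier G" and ne: "x \<otimes> y \<noteq> y \<otimes> x"
  have "x \<noteq> \<one>" "y \<noteq> \<one>" "x \<noteq> y" using ne xy by auto
  moreover have "x \<otimes> y \<noteq> \<one>" "y \<otimes> x \<noteq> \<one>" using ne xy inv_comm by metis+
  moreover have "x \<otimes> y \<noteq> x" "y \<otimes> x \<noteq> x" "x \<otimes> y \<noteq> y" "y \<otimes> x \<noteq> y"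
    using \<open>x \<noteq> \<one>\<close> \<open>y \<noteq> \<one>\<close> xy by (metis l_cancel_one r_cancel_one)+
  ultimately have "card {\<one>, x, y, x \<otimes> y, y \<otimes> x} = 5" using ne by (simp add: card_insert_if)
  moreover have "card {\<one>, x, y, x \<otimes> y, y \<otimes> x} \<le> card (carrier G)"
    using xy fin by (intro card_mono) auto
  ultimately show False using card by simp
qed

section \<open>Enumeration of the subgroups of the dihedral group of order 8\<close>

text \<open>This and the next three definitions are an executable copy of \<open>D8\<close>, with
  explicit inverses and with lists in place of carrier sets, so that the counts can be
  evaluated.\<close>

definition D8_mult :: "int \<times> bool \<Rightarrow> int \<times> bool \<Rightarrow> int \<times> bool" where
  "D8_mult = (\<lambda>(i, a) (j, b). ((if a then i - j else i + j) mod 4, a \<noteq> b))"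

definition D8_inv :: "int \<times> bool \<Rightarrow> int \<times> bool" where
  "D8_inv = (\<lambda>(i, a). (if a then i else (- i) mod 4, a))"

definition D8_elements :: "(int \<times> bool) list" where
  "D8_elements =
     [(0, False), (1, False), (2, False), (3, False), (0, True), (1, True), (2, True), (3, True)]"

definition D8_subgroups :: "(int \<times> bool) list list" where
  "D8_subgroups = filter (\<lambda>xs. (0, False) \<in> set xs \<and>
     (\<forall>a \<in> set xs. D8_inv a \<in> set xs \<and> (\<forall>b \<in> set xs. D8_mult a b \<in> set xs))) (subseqs D8_elements)"

lemma carrier_D8: "carrier D8 = set D8_elements"
proof -
  have "{0..<4::int} = {0, 1, 2, 3}" by auto
  then show ?thesis by (auto simp: dihedral_group_def D8_elements_def UNIV_bool)
qed

lemma group_D8: "group D8" by (rule group_dihedral_group) simp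

lemma mult_D8: "x \<otimes>\<^bsub>D8\<^esub> y = D8_mult x y"
  by (simp add: dihedral_group_def D8_mult_def)

lemma inv_D8:
  assumes "x \<in> carrier D8"
  shows "inv\<^bsub>D8\<^esub> x = D8_inv x"
proof -
  interpret group D8 by (rule group_D8)
  show ?thesis
    by (rule inv_equality) (use assms in \<open>auto simp: dihedral_group_def D8_inv_def mod_simps\<close>)
qed

text \<open>Being a subgroup becomes a decidable closure test, applied to all subsets of the eight
  elements.\<close>

lemma subgroups_D8: "{H. subgroup H D8} = set ` set D8_subgroups"
proof -
  interpret group D8 by (rule group_D8)
  have one: "\<one>\<^bsub>D8\<^esub> = (0, False)" by (simp add: dihedral_group_def)
  have "subgroup H D8 \<longleftrightarrow> H \<in> Pow (set D8_elements) \<and> (0, False) \<in> H \<and>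
     (\<forall>a \<in> H. D8_inv a \<in> H \<and> (\<forall>b \<in> H. D8_mult a b \<in> H))" (is "_ \<longleftrightarrow> ?R") for H
  proof
    assume "subgroup H D8"
    then interpret H: subgroup H D8 .
    have "D8_inv a \<in> H" if "a \<in> H" for a
      using H.m_inv_closed[OF that] inv_D8[OF H.mem_carrier[OF that]] by simp
    moreover have "D8_mult a b \<in> H" if "a \<in> H" "b \<in> H" for a b
      using H.m_closed[OF that] by (simp add: mult_D8)
    ultimately show ?R using H.subset H.one_closed by (simp add: one carrier_D8)
  next
    assume ?R
    then have R: "H \<subseteq> carrier D8" "\<one>\<^bsub>D8\<^esub> \<in> H" "\<And>a. a \<in> H \<Longrightarrow> D8_inv a \<in> H"
      "\<And>a b. a \<in> H \<Longrightarrow> b \<in> H \<Longrightarrow> D8_mult a b \<in> H"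
      by (simp_all only: carrier_D8 one Pow_iff)
    show "subgroup H D8"
    proof
      show "inv\<^bsub>D8\<^esub> a \<in> H" if "a \<in> H" for a
        using R(3)[OF that] inv_D8[of a] R(1) that by auto
    qed (use R in \<open>simp_all only: mult_D8\<close>)
  qed
  then have "{H. subgroup H D8} = {H \<in> set ` set (subseqs D8_elements). (0, False) \<in> H \<and>
     (\<forall>a \<in> H. D8_inv a \<in> H \<and> (\<forall>b \<in> H. D8_mult a b \<in> H))}"
    unfolding subseqs_powset by auto
  also have "\<dots> = set ` set D8_subgroups" by (auto simp: D8_subgroups_def)
  finally show ?thesis .
qed

lemma conjugate_D8:
  assumes "g \<in> carrier D8"
  shows "conjugate D8 g H = (\<lambda>h. D8_mult (D8_mult g h) (D8_inv g)) ` H"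
  using assms by (simp add: conjugate_def mult_D8 inv_D8)

lemma d_prime_D8: "d_prime D8 = 4 / 5"
proof -
  interpret group D8 by (rule group_D8)
  have "subgroup_conj_classes D8 = (\<lambda>H. (\<lambda>g. conjugate D8 g H) ` carrier D8) ` {H. subgroup H D8}"
    unfolding subgroup_conj_classes_eq Setcompr_eq_image image_Collect ..
  also have "\<dots> = (\<lambda>H. (\<lambda>g. (\<lambda>h. D8_mult (D8_mult g h) (D8_inv g)) ` H) ` set D8_elements)
      ` set ` set D8_subgroups"
    unfolding subgroups_D8 by (intro image_cong refl) (simp_all add: conjugate_D8 carrier_D8)
  \<comment> \<open>Of the ten subgroups six are normal, and the four generated by a reflection form
    two classes of size two.\<close>
  also have "card \<dots> = 8" by code_simp
  finally have "card (subgroup_conj_classes D8) = 8" .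
  moreover have "card (set ` set D8_subgroups) = 10" by code_simp
  ultimately show ?thesis by (simp add: d_prime_def subgroup_lattice_def subgroups_D8)
qed

section \<open>Sections and the value of \<open>d_star\<close>\<close>

lemma finite_sections:
  assumes "group G" "finite (carrier G)"
  shows "finite (sections G)"
proof (rule finite_subset)
  show "sections G \<subseteq> (\<lambda>(H, K). G\<lparr>carrier := H\<rparr> Mod K) ` (Pow (carrier G) \<times> Pow (carrier G))"
  proof
    fix S assume "S \<in> sections G"
    then obtain H K where HK: "S = G\<lparr>carrier := H\<rparr> Mod K" "subgroup H G" "K \<lhd> G\<lparr>carrier := H\<rparr>"
      by (auto simp: sections_def)
    have "H \<subseteq> carrier G" "K \<subseteq> H"
      using subgroup.subset[OF HK(2)] subgroup.subset[OF normal_imp_subgroup[OF HK(3)]] by auto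
    then show "S \<in> (\<lambda>(H, K). G\<lparr>carrier := H\<rparr> Mod K) ` (Pow (carrier G) \<times> Pow (carrier G))"
      by (intro rev_image_eqI[of "(H, K)"]) (simp_all add: HK(1))
  qed
qed (use assms in simp)

lemma (in group) mostly_normal_sections:
  assumes fin: "finite (carrier G)" and d: "d_star G > 4 / 5"
    and H: "subgroup H G" and K: "K \<lhd> G\<lparr>carrier := H\<rparr>"
  shows "mostly_normal (G\<lparr>carrier := H\<rparr> Mod K)"
proof -
  interpret K: normal K "G\<lparr>carrier := H\<rparr>" by (rule K)
  have "finite (carrier (G\<lparr>carrier := H\<rparr>))"
    using fin subgroup.subset[OF H] by (auto intro: finite_subset)
  then have finS: "finite (carrier (G\<lparr>carrier := H\<rparr> Mod K))" by (rule K.finite_Mod)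
  have "G\<lparr>carrier := H\<rparr> Mod K \<in> sections G" using H K by (auto simp: sections_def)
  then have "d_star G \<le> d_prime (G\<lparr>carrier := H\<rparr> Mod K)"
    unfolding d_star_def using finite_sections[OF is_group fin] by (intro Min_le) auto
  then have "d_prime (G\<lparr>carrier := H\<rparr> Mod K) > 4 / 5" using d by simp
  then show ?thesis by (rule group.mostly_normal_if_d_prime[OF K.factorgroup_is_group finS])
qed

text \<open>A section has order dividing 8. Up to order 4 it is abelian and has value 1; at order 8
  it can only be the quotient of the whole group by the trivial subgroup, which is isomorphic to
  \<open>D8\<close> and attains the minimum.\<close>

lemma d_star_D8: "d_star D8 = 4 / 5"
proof -
  interpret group D8 by (rule group_D8)
  have fin: "finite (carrier D8)" by (simp add: carrier_D8)
  have card8: "card (carrier D8) = 8" using order_dihedral_group[of 4] by (simp add: order_def)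
  have triv: "d_prime (D8 Mod {\<one>\<^bsub>D8\<^esub>}) = 4 / 5"
  proof -
    have "group (D8 Mod {\<one>\<^bsub>D8\<^esub>})" by (rule normal.factorgroup_is_group[OF one_is_normal])
    moreover have "finite (carrier (D8 Mod {\<one>\<^bsub>D8\<^esub>}))"
      by (rule normal.finite_Mod[OF one_is_normal fin])
    ultimately show ?thesis
      using group.d_prime_iso[OF _ group_D8 trivial_factor_iso] d_prime_D8 by simp
  qed
  have "4 / 5 \<le> d_prime S" if S: "S \<in> sections D8" for S
  proof -
    obtain H K where HK: "S = D8\<lparr>carrier := H\<rparr> Mod K" "subgroup H D8" "K \<lhd> D8\<lparr>carrier := H\<rparr>"
      using S by (auto simp: sections_def)
    interpret K: normal K "D8\<lparr>carrier := H\<rparr>" by (rule HK(3))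
    interpret S: group S unfolding HK(1) by (rule K.factorgroup_is_group)
    have finH: "finite H" using subgroup.subset[OF HK(2)] fin by (rule finite_subset)
    have finS: "finite (carrier S)" unfolding HK(1) by (rule K.finite_Mod) (use finH in simp)
    have KH: "card (carrier S) * card K = card H"
      using K.lagrange[OF K.is_subgroup] by (simp add: HK(1) FactGroup_def order_def)
    have H8: "card H dvd 8" using lagrange[OF HK(2)] card8 by (metis dvd_triv_right order_def)
    have "card (carrier S) dvd card H" unfolding KH[symmetric] by simp
    also note H8
    finally have dvd: "card (carrier S) dvd 2 ^ 3" by simp
    show ?thesis
    proof (cases "card (carrier S) \<le> 4")
      case True
      then have "comm_group S" by (rule S.comm_group_if_card_le_4[OF finS])
      then have "d_prime S = 1"
        by (intro S.d_prime_eq_1_if_all_normal[OF finS] comm_group.subgroup_imp_normal)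
      then show ?thesis by simp
    next
      case False
      obtain k where k: "card (carrier S) = 2 ^ k" "k \<le> 3"
        using dvd divides_primepow_nat[of 2 "card (carrier S)" 3] two_is_prime_nat by blast
      then have "card (carrier S) = 8" using False by (auto simp: le_Suc_eq numeral_3_eq_3)
      \<comment> \<open>Since \<open>card H\<close> is positive and at most 8, this leaves only
        \<open>card K = 1\<close> and \<open>card H = 8\<close>.\<close>
      then have "8 * card K = card H" using KH by simp
      moreover have "0 < card H" using H8 by (auto intro: Nat.gr0I)
      moreover have "card H \<le> 8" using H8 by (rule dvd_imp_le) simp
      ultimately have "card K = 1" "card H = 8" by presburger+
      then have "H = carrier D8" "K = {\<one>\<^bsub>D8\<^esub>}"
        using card_subset_eq[OF fin subgroup.subset[OF HK(2)]] card8
          subgroup.one_closed[OF K.is_subgroup] by (auto simp: card_1_singleton_iff)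
      then have "S = D8 Mod {\<one>\<^bsub>D8\<^esub>}" using HK(1) by simp
      then show ?thesis using triv by simp
    qed
  qed
  moreover have "D8 Mod {\<one>\<^bsub>D8\<^esub>} \<in> sections D8"
    unfolding sections_def using subgroup_self one_is_normal
    by (intro CollectI exI[of _ "carrier D8"] exI[of _ "{\<one>\<^bsub>D8\<^esub>}"]) simp
  ultimately show ?thesis
    unfolding d_star_def using finite_sections[OF group_D8 fin] triv
    by (intro Min_eqI) (auto intro: rev_image_eqI)
qed

theorem theoremC:
  fixes G :: "('a, 'b) monoid_scheme"
  assumes "group G" and "finite (carrier G)"
  shows "(d_star G > 4 / 5 \<longrightarrow> iwasawa_group G) \<and> d_star D8 = 4 / 5 \<and> d_prime D8 = 4 / 5"
proof -
  interpret group G by fact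
  have "iwasawa_group G" if d: "d_star G > 4 / 5"
  proof -
    have mn: "mostly_normal (G\<lparr>carrier := H\<rparr> Mod R)" if "subgroup H G" "R \<lhd> G\<lparr>carrier := H\<rparr>" for H R
      using mostly_normal_sections[OF assms(2) d that] .
    have "nilpotent_group G"
      using nilpotent_group_if_normalizer_condition[OF assms(2)]
        normalizer_condition_if_mostly_normal[OF assms(2) mn] by blast
    moreover have "modular_lattice (subgroup_lattice G)"
    proof (rule modular_lattice_if_permutable)
      fix A B assume AB: "subgroup A G" "subgroup B G"
      show "A <#>\<^bsub>G\<^esub> B = B <#>\<^bsub>G\<^esub> A"
        by (rule permutable_if_cyclic_permutable[OF _ AB], rule cyclic_permutable[OF assms(2) mn])
    qed
    ultimately show ?thesis by (simp add: iwasawa_group_def)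
  qed
  then show ?thesis using d_star_D8 d_prime_D8 by blast
qed

end
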